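(* (a) Suppose that $$e_i(n)\notin \mathrm{span}(X)\quad\text{for every } i\in I_1(\mathfrak M_0^{lin}). \qquad (\mathrm{N}_{uc})$$ Then for every $0<\alpha<1$ there exists a real number $C(\alpha)$ such that $$\sup_{\mu_0\in\mathfrak M_0}\ \sup_{0<\sigma^2<\infty}\ \sup_{\Sigma\in\mathfrak C_{Het}} P_{\mu_0,\sigma^2\Sigma}(T_{uc}\ge C(\alpha))\le\alpha. \qquad (\mathrm{S}_{uc})$$ Furthermore, under $(\mathrm N_{uc})$, even equality can be achieved in $(\mathrm S_{uc})$ by a proper choice of $C(\alpha)$, provided $\alpha\in(0,\alpha^*]\cap(0,1)$, where $\alpha^*=\sup_{C\in(C^*,\infty)}\sup_{\Sigma\in\mathfrak C_{Het}}P_{\mu_0,\Sigma}(T_{uc}\ge C)$ is positive and where $C^*=\max\{T_{uc}(\mu_0+e_i(n)): i\in I_1(\mathfrak M_0^{lin})\}$ for $\mu_0\in\mathfrak M_0$ (with neither $\alpha^*$ nor $C^*$ depending on the choice of $\mu_0\in\mathfrak M_0$). (b) Suppose Assumption 1 (see context) is satisfied and that $$e_i(n)\notin \mathsf B\quad\text{for every } i\in I_1(\mathfrak M_0^{lin}). \qquad (\mathrm{N}_{Het})$$ Then for every $0<\alpha<1$ there exists a real number $C(\alpha)$ such that $$\sup_{\mu_0\in\mathfrak M_0}\ \sup_{0<\sigma^2<\infty}\ \sup_{\Sigma\in\mathfrak C_{Het}} P_{\mu_0,\sigma^2\Sigma}(T_{Het}\ge C(\alpha))\le\alpha. \qquad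 (\mathrm{S}_{Het})$$ Furthermore, under $(\mathrm N_{Het})$, even equality can be achieved in $(\mathrm S_{Het})$ by a proper choice of $C(\alpha)$, provided $\alpha\in(0,\alpha^*]\cap(0,1)$, where now $\alpha^*=\sup_{C\in(C^*,\infty)}\sup_{\Sigma\in\mathfrak C_{Het}}P_{\mu_0,\Sigma}(T_{Het}\ge C)$ is positive and where $C^*=\max\{T_{Het}(\mu_0+e_i(n)): i\in I_1(\mathfrak M_0^{lin})\}$ for $\mu_0\in\mathfrak M_0$ (with neither $\alpha^*$ nor $C^*$ depending on the choice of $\mu_0\in\mathfrak M_0$). (c) Under the assumptions of Part (a) (Part (b), respectively), a smallest critical value, denoted by $C_\Diamond(\alpha)$, satisfying $(\mathrm S_{uc})$ ($(\mathrm S_{Het})$, respectively) exists for every $0<\alpha<1$. And $C_\Diamond(\alpha)$ corresponding to Part (a) (Part (b), respectively) is also the smallest among the critical values leading to equality in $(\mathrm S_{uc})$ ($(\mathrm S_{Het})$, respectively) whenever such critical values exist.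
   Context: Setting. $n,k,q$ are integers with $1\le k<n$ and $q\ge1$; $X\in\mathbb R^{n\times k}$ has rank $k$, $R\in\mathbb R^{q\times k}$ has rank $q$, and $r\in\mathbb R^q$; all are fixed. $A'$ is the transpose of $A$, $\mathrm{span}(A)$ the column space, $e_i(n)$ the $i$-th standard basis vector of $\mathbb R^n$. $\mathfrak M_0=\{X\beta:\beta\in\mathbb R^k, R\beta=r\}$, $\mathfrak M_0^{lin}=\{X\beta: R\beta=0\}$. $I_0(\mathfrak M_0^{lin})=\{i\in\{1,\dots,n\}: e_i(n)\in\mathfrak M_0^{lin}\}$ and $I_1(\mathfrak M_0^{lin})=\{1,\dots,n\}\setminus I_0(\mathfrak M_0^{lin})$ (nonempty since $\dim\mathfrak M_0^{lin}=k-q<n$). $P_{\mu,A}$ is the Gaussian measure on $\mathbb R^n$ with mean $\mu$ and covariance matrix $A$. The heteroskedasticity model is $$\mathfrak C_{Het}=\Big\{\mathrm{diag}(\tau_1^2,\dots,\tau_n^2): \tau_i^2>0\text{ for all } i,\ \sum_{i=1}^n\tau_i^2=1\Big\}.$$ $\hat\beta(y)=(X'X)^{-1}X'y$, $\hat u(y)=y-X\hat\beta(y)$ for $y\in\mathbb R^n$. Test statistics. With $\hat\sigma^2(y)=\hat u(y)'\hat u(y)/(n-k)$, $$T_{uc}(y)=(R\hat\beta(y)-r)'\big(\hat\sigma^2(y)R(X'X)^{-1}R'\big)^{-1}(R\hat\beta(y)-r)\ \text{ if } y\notin\mathrm{span}(X),\qquad T_{uc}(y)=0\ \text{ if } y\in\mathrm{span}(X).$$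 With fixed constants $d_1,\dots,d_n>0$ (possibly depending on $X$) and $\hat\Omega_{Het}(y)=R(X'X)^{-1}X'\,\mathrm{diag}(d_1\hat u_1^2(y),\dots,d_n\hat u_n^2(y))\,X(X'X)^{-1}R'$, $$T_{Het}(y)=(R\hat\beta(y)-r)'\hat\Omega_{Het}^{-1}(y)(R\hat\beta(y)-r)\ \text{ if }\det\hat\Omega_{Het}(y)\ne0,\qquad T_{Het}(y)=0\ \text{ otherwise}.$$ Assumption 1. Let $X'(\lnot)$ be the matrix obtained from $X'$ by deleting all columns with index $i$ such that $e_i(n)\in\mathrm{span}(X)$ (no column is deleted if there is no such $i$). Then $\mathrm{rank}(R(X'X)^{-1}X'(\lnot))=q$. The set $\mathsf B$: $\mathsf B=\{y\in\mathbb R^n:\mathrm{rank}(B(y))<q\}$ with $B(y)=R(X'X)^{-1}X'\,\mathrm{diag}(\hat u_1(y),\dots,\hat u_n(y))$. *)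

theory Defs
  imports "HOL-Analysis.Analysis"
begin

definition diag :: "real^'n \<Rightarrow> real^'n^'n" where
  "diag v = (\<chi> i j. if i = j then v $ i else 0)"

abbreviation e :: "'n::finite \<Rightarrow> real^'n" where
  "e i \<equiv> axis i 1"

definition quad_form :: "real^'q^'q \<Rightarrow> real^'q \<Rightarrow> real" where
  "quad_form A v = v \<bullet> (A *v v)"

text \<open>The Gaussian measure with mean \<open>\<mu>\<close> and covariance matrix \<open>A\<close>, given by its Lebesgue density.
  This is the right object for symmetric positive definite \<open>A\<close>, the only case used below.\<close>

definition gaussian :: "real^'n \<Rightarrow> real^'n^'n \<Rightarrow> (real^'n) measure" where
  "gaussian \<mu> A = density lborel
     (\<lambda>y. ennreal (exp (- quad_form (matrix_inv A) (y - \<mu>) / 2)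
                   / sqrt ((2 * pi) ^ CARD('n) * det A)))"

definition C_Het :: "(real^'n^'n) set" where
  "C_Het = {diag (\<chi> i. (\<tau> $ i)\<^sup>2) | \<tau> :: real^'n.
              (\<forall>i. 0 < (\<tau> $ i)\<^sup>2) \<and> (\<Sum>i\<in>UNIV. (\<tau> $ i)\<^sup>2) = 1}"

definition M0 :: "real^'k^'n \<Rightarrow> real^'k^'q \<Rightarrow> real^'q \<Rightarrow> (real^'n) set" where
  "M0 X R r = {X *v \<beta> | \<beta>. R *v \<beta> = r}"

definition M0_lin :: "real^'k^'n \<Rightarrow> real^'k^'q \<Rightarrow> (real^'n) set" where
  "M0_lin X R = {X *v \<beta> | \<beta>. R *v \<beta> = 0}"

definition I0 :: "(real^'n) set \<Rightarrow> 'n set" where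
  "I0 L = {i. e i \<in> L}"

definition I1 :: "(real^'n) set \<Rightarrow> 'n set" where
  "I1 L = UNIV - I0 L"

abbreviation col_space :: "real^'k^'n \<Rightarrow> (real^'n) set" where
  "col_space X \<equiv> span (columns X)"

definition beta_hat :: "real^'k^'n \<Rightarrow> real^'n \<Rightarrow> real^'k" where
  "beta_hat X y = matrix_inv (transpose X ** X) *v (transpose X *v y)"

definition u_hat :: "real^'k^'n \<Rightarrow> real^'n \<Rightarrow> real^'n" where
  "u_hat X y = y - X *v beta_hat X y"

definition sigma2_hat :: "real^'k^'n \<Rightarrow> real^'n \<Rightarrow> real" where
  "sigma2_hat X y = (u_hat X y \<bullet> u_hat X y) / (real CARD('n) - real CARD('k))"

definition T_uc :: "real^'k^'n \<Rightarrow> real^'k^'q \<Rightarrow> real^'q \<Rightarrow> real^'n \<Rightarrow> real" where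
  "T_uc X R r y =
     (if y \<notin> col_space X
      then quad_form
             (matrix_inv (sigma2_hat X y *\<^sub>R (R ** matrix_inv (transpose X ** X) ** transpose R)))
             (R *v beta_hat X y - r)
      else 0)"

definition Omega_Het :: "real^'n \<Rightarrow> real^'k^'n \<Rightarrow> real^'k^'q \<Rightarrow> real^'n \<Rightarrow> real^'q^'q" where
  "Omega_Het d X R y =
     R ** matrix_inv (transpose X ** X) ** transpose X
       ** diag (\<chi> i. d $ i * (u_hat X y $ i)\<^sup>2)
       ** X ** matrix_inv (transpose X ** X) ** transpose R"

definition T_Het :: "real^'n \<Rightarrow> real^'k^'n \<Rightarrow> real^'k^'q \<Rightarrow> real^'q \<Rightarrow> real^'n \<Rightarrow> real" where
  "T_Het d X R r y =
     (if det (Omega_Het d X R y) \<noteq> 0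
      then quad_form (matrix_inv (Omega_Het d X R y)) (R *v beta_hat X y - r)
      else 0)"

text \<open>The number of deleted columns is not available as a type, so a deleted column is
  blanked out by zeros instead. The two lemmas below show that the rank of a product \<open>A ** M\<close> is
  the same as if the columns of \<open>M\<close> had really been removed.\<close>

definition delete_columns :: "'n set \<Rightarrow> real^'n^'k \<Rightarrow> real^'n^'k" where
  "delete_columns J M = (\<chi> a i. if i \<in> J then 0 else M $ a $ i)"

lemma rank_delete_columns:
  fixes A :: "real^'k^'q" and M :: "real^'n^'k"
  shows "rank (A ** delete_columns J M) = dim {column i (A ** M) | i. i \<notin> J}"
proof -
  have *: "column i (A ** delete_columns J M) = (if i \<in> J then 0 else column i (A ** M))" for i
    by (simp add: column_def delete_columns_def matrix_matrix_mult_def vec_eq_iff)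
  have "insert 0 (columns (A ** delete_columns J M)) = insert 0 {column i (A ** M) | i. i \<notin> J}"
    unfolding columns_def * by auto
  then have "span (columns (A ** delete_columns J M)) = span {column i (A ** M) | i. i \<notin> J}"
    using span_insert_0[of "columns (A ** delete_columns J M)"]
      span_insert_0[of "{column i (A ** M) | i. i \<notin> J}"] by simp
  then show ?thesis
    unfolding column_rank_def
    using dim_span[of "columns (A ** delete_columns J M)"]
      dim_span[of "{column i (A ** M) | i. i \<notin> J}"] by simp
qed

lemma rank_delete_columns_submatrix:
  fixes A :: "real^'k^'q" and M :: "real^'n^'k" and f :: "'m::finite \<Rightarrow> 'n"
  assumes "range f = - J"
  shows "rank (A ** delete_columns J M) = rank (A ** (\<chi> a i. M $ a $ f i))"
proof -
  have "column i (A ** (\<chi> a i. M $ a $ f i)) = column (f i) (A ** M)" for i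
    by (simp add: column_def matrix_matrix_mult_def vec_eq_iff)
  then have "columns (A ** (\<chi> a i. M $ a $ f i)) = (\<lambda>j. column j (A ** M)) ` range f"
    unfolding columns_def by auto
  also have "\<dots> = {column i (A ** M) | i. i \<notin> J}"
    unfolding assms by auto
  finally show ?thesis
    unfolding rank_delete_columns by (simp add: column_rank_def)
qed

definition Assumption1 :: "real^'k^'n \<Rightarrow> real^'k^'q \<Rightarrow> bool" where
  "Assumption1 X R \<longleftrightarrow>
     rank (R ** matrix_inv (transpose X ** X)
             ** delete_columns {i. e i \<in> col_space X} (transpose X)) = CARD('q)"

definition B_mat :: "real^'k^'n \<Rightarrow> real^'k^'q \<Rightarrow> real^'n \<Rightarrow> real^'n^'q" where
  "B_mat X R y = R ** matrix_inv (transpose X ** X) ** transpose X ** diag (u_hat X y)"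

definition B_set :: "real^'k^'n \<Rightarrow> real^'k^'q \<Rightarrow> (real^'n) set" where
  "B_set X R = {y. rank (B_mat X R y) < CARD('q)}"

definition N_uc :: "real^'k^'n \<Rightarrow> real^'k^'q \<Rightarrow> bool" where
  "N_uc X R \<longleftrightarrow> (\<forall>i \<in> I1 (M0_lin X R). e i \<notin> col_space X)"

definition N_Het :: "real^'k^'n \<Rightarrow> real^'k^'q \<Rightarrow> bool" where
  "N_Het X R \<longleftrightarrow> (\<forall>i \<in> I1 (M0_lin X R). e i \<notin> B_set X R)"

text \<open>The suprema below are taken in \<open>real\<close>; they are genuine suprema because the probabilities are
  bounded by 0 and 1 and all index sets (including \<open>M0 X R r\<close> when \<open>R\<close> has full row rank) are nonempty.\<close>

definition rej_prob :: "(real^'n \<Rightarrow> real) \<Rightarrow> real \<Rightarrow> real^'n \<Rightarrow> real^'n^'n \<Rightarrow> real" where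
  "rej_prob T C \<mu> A = measure (gaussian \<mu> A) {y. T y \<ge> C}"

definition test_size :: "(real^'n) set \<Rightarrow> (real^'n \<Rightarrow> real) \<Rightarrow> real \<Rightarrow> real" where
  "test_size M T C =
     (SUP \<mu>0\<in>M. SUP \<sigma>2\<in>{0<..}. SUP \<Sigma>\<in>C_Het. rej_prob T C \<mu>0 (\<sigma>2 *\<^sub>R \<Sigma>))"

definition C_star :: "(real^'n) set \<Rightarrow> (real^'n \<Rightarrow> real) \<Rightarrow> real^'n \<Rightarrow> real" where
  "C_star L T \<mu>0 = Max {T (\<mu>0 + e i) | i. i \<in> I1 L}"

definition alpha_star :: "(real^'n) set \<Rightarrow> (real^'n \<Rightarrow> real) \<Rightarrow> real^'n \<Rightarrow> real" where
  "alpha_star L T \<mu>0 = (SUP C\<in>{C_star L T \<mu>0<..}. SUP \<Sigma>\<in>C_Het. rej_prob T C \<mu>0 \<Sigma>)"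

definition is_smallest :: "real \<Rightarrow> real set \<Rightarrow> bool" where
  "is_smallest c S \<longleftrightarrow> c \<in> S \<and> (\<forall>x\<in>S. c \<le> x)"

end

theory Submission
  imports Defs "HOL-Probability.Distributions"
begin

text \<open>Centered at a point of the null hypothesis, either test statistic is a quotient \<open>N / D\<close> of
  polynomials, is invariant under scaling, and depends only on the coordinates in
  \<open>I\<^sub>1\<close>. Hence its law under \<open>diag(\<tau>\<^sub>1\<^sup>2, \<dots>, \<tau>\<^sub>n\<^sup>2)\<close> depends only on the scales \<open>\<tau>\<^sub>i\<close> with \<open>i \<in> I\<^sub>1\<close>,
  normalized to the unit sphere, and these range over a relatively compact set. In every degenerate limit
  some \<open>\<tau>\<^sub>i\<close> with \<open>i \<in> I\<^sub>1\<close> survives, and since \<open>D(e\<^sub>i) \<noteq> 0\<close> the polynomial \<open>D\<close> does not vanish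
  identically along the limiting distribution. The zeros of a nonzero polynomial form a null set, so
  the statistic is almost surely continuous there; this gives size control. For \<open>C\<close> above \<open>C\<^sup>*\<close> the same
  applies to \<open>N - C D\<close>, so the limiting laws have no atom at \<open>C\<close> and the size is continuous on
  \<open>(C\<^sup>*, \<infinity>)\<close>. Nondegenerate laws have no atoms at all, whence the size is right-continuous everywhere.\<close>

subsection \<open>Zero sets of polynomials\<close>

lemma real_polynomial_function_finite_zeros:
  fixes p :: "real \<Rightarrow> real"
  assumes "real_polynomial_function p" and "p a \<noteq> 0"
  shows "finite {x. p x = 0}"
proof -
  obtain c n where p: "p = (\<lambda>x. \<Sum>i\<le>n. c i * x ^ i)"
    using assms(1) by (auto simp: real_polynomial_function_iff_sum)
  have "\<exists>k\<le>n. c k \<noteq> 0"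
    using assms(2) unfolding p by (auto intro: ccontr)
  then show ?thesis
    unfolding p by (simp add: polyfun_finite_roots)
qed

lemma continuous_on_real_polynomial_function:
  "real_polynomial_function p \<Longrightarrow> continuous_on S p"
  by (simp add: real_polynomial_function_eq continuous_on_polymonial_function)

lemma measurable_real_polynomial_function:
  fixes p :: "'a::euclidean_space \<Rightarrow> real"
  assumes "real_polynomial_function p"
  shows "p \<in> borel_measurable borel"
  using assms by (intro borel_measurable_continuous_onI continuous_on_real_polynomial_function)

text \<open>Every ray issuing from \<open>a\<close> contains only finitely many zeros. By Tonelli, almost every dilation
  of the zero set about \<open>a\<close> is null, and dilations preserve null sets.\<close>

lemma AE_real_polynomial_function_neq_0:
  fixes p :: "'a::euclidean_space \<Rightarrow> real"
  assumes p: "real_polynomial_function p" and a: "p a \<noteq> 0"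
  shows "AE x in lborel. p x \<noteq> 0"
proof -
  have "AE t in lborel. p (a + t *\<^sub>R x) \<noteq> 0" for x
  proof -
    have "polynomial_function (\<lambda>t. a + t *\<^sub>R x)"
      by (intro polynomial_function_add polynomial_function_const polynomial_function_bounded_linear
          bounded_linear_scaleR_left)
    from real_polynomial_function_compose[OF this p]
    have "finite {t. p (a + t *\<^sub>R x) = 0}"
      by (intro real_polynomial_function_finite_zeros[where a = 0]) (auto simp: o_def a)
    from AE_not_in[OF finite_imp_null_set_lborel[OF this]] show ?thesis
      by simp
  qed
  then have "AE x::'a in lborel. AE t::real in lborel. p (a + t *\<^sub>R x) \<noteq> 0"
    by simp
  moreover have [measurable]: "p \<in> borel_measurable borel"
    using p by (rule measurable_real_polynomial_function)
  ultimately have "AE t::real in lborel. AE x::'a in lborel. p (a + t *\<^sub>R x) \<noteq> 0"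
    by (subst (asm) lborel_pair.AE_commute) measurable
  moreover have "AE t::real in lborel. t \<noteq> 0"
    by (rule AE_lborel_singleton)
  ultimately have "AE t::real in lborel. t \<noteq> 0 \<and> (AE x::'a in lborel. p (a + t *\<^sub>R x) \<noteq> 0)"
    by auto
  moreover have "ae_filter (lborel :: real measure) \<noteq> bot"
    by (simp add: ae_filter_eq_bot_iff)
  ultimately obtain t :: real where t: "t \<noteq> 0" and AE: "AE x::'a in lborel. p (a + t *\<^sub>R x) \<noteq> 0"
    using eventually_happens' by blast
  show ?thesis
    by (subst lborel_affine[OF t, of a]) (use t AE in \<open>simp add: AE_density AE_distr_iff\<close>)
qed

subsection \<open>Gaussian measures with diagonal covariance\<close>

definition std_gaussian :: "(real^'n) measure" where
  "std_gaussian = gaussian 0 (mat 1)"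

text \<open>\<open>matrix_inv\<close> is chosen as some two-sided inverse. For square matrices a
  right inverse is automatically two-sided, and inverses are unique.\<close>

lemma matrix_inv_eqI:
  fixes A B :: "real^'n^'n"
  assumes "A ** B = mat 1"
  shows "matrix_inv A = B"
proof -
  have "B ** A = mat 1"
    using assms matrix_left_right_inverse by blast
  then have "A ** matrix_inv A = mat 1"
    unfolding matrix_inv_def using assms by (metis (mono_tags, lifting) someI_ex)
  then show ?thesis
    by (metis \<open>B ** A = mat 1\<close> matrix_mul_assoc matrix_mul_lid matrix_mul_rid)
qed

lemma matrix_inv_mat_1: "matrix_inv (mat 1 :: real^'n^'n) = mat 1"
  by (rule matrix_inv_eqI) simp

text \<open>The product form lets the total mass be computed one coordinate at a time.\<close>

lemma std_gaussian_eq_density: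
  "(std_gaussian :: (real^'n) measure) =
     density lborel (\<lambda>x. ennreal (\<Prod>b\<in>Basis. std_normal_density (x \<bullet> b)))"
  unfolding std_gaussian_def gaussian_def
proof (intro arg_cong[where f = "density lborel"] ext arg_cong[where f = ennreal])
  fix x :: "real^'n"
  have "(\<Prod>b\<in>Basis. std_normal_density (x \<bullet> b))
      = (\<Prod>b\<in>(Basis::(real^'n) set). 1 / sqrt (2 * pi)) * (\<Prod>b\<in>Basis. exp (- (x \<bullet> b)\<^sup>2 / 2))"
    unfolding std_normal_density_def by (rule prod.distrib)
  also have "(\<Prod>b\<in>Basis. exp (- (x \<bullet> b)\<^sup>2 / 2)) = exp (- (x \<bullet> x) / 2)"
    using euclidean_inner[of x x]
    by (simp add: exp_sum[symmetric] sum_negf sum_divide_distrib[symmetric] power2_eq_square)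
  also have "(\<Prod>b\<in>(Basis::(real^'n) set). 1 / sqrt (2 * pi)) = 1 / sqrt ((2 * pi) ^ CARD('n))"
    by (subst real_sqrt_power) (simp add: power_divide)
  finally show "exp (- quad_form (matrix_inv (mat 1)) (x - 0) / 2) / sqrt ((2 * pi) ^ CARD('n) * det (mat 1 :: real^'n^'n))
      = (\<Prod>b\<in>Basis. std_normal_density (x \<bullet> b))"
    by (simp add: matrix_inv_mat_1 quad_form_def)
qed

lemma sets_std_gaussian [measurable_cong]: "sets std_gaussian = sets borel"
  by (simp add: std_gaussian_def gaussian_def)

lemma space_std_gaussian [simp]: "space std_gaussian = UNIV"
  by (simp add: std_gaussian_def gaussian_def)

lemma prob_space_std_gaussian: "prob_space (std_gaussian :: (real^'n) measure)"
proof
  have [simp]: "(\<integral>\<^sup>+ x. ennreal (std_normal_density x) \<partial>lborel) = 1"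
    using prob_space.emeasure_space_1[OF prob_space_normal_density[of 1 0]]
    by (simp add: emeasure_density)
  have "emeasure (std_gaussian :: (real^'n) measure) UNIV
      = (\<integral>\<^sup>+ x. (\<Prod>b\<in>(Basis::(real^'n) set). ennreal (std_normal_density (x \<bullet> b))) \<partial>lborel)"
    unfolding std_gaussian_eq_density by (simp add: emeasure_density prod_ennreal)
  also have "\<dots> = 1"
    by (subst nn_integral_lborel_prod) auto
  finally show "emeasure (std_gaussian :: (real^'n) measure) (space std_gaussian) = 1"
    by simp
qed

text \<open>The density is positive everywhere, so the Gaussian and Lebesgue measures have the same
  null sets. This carries the result on zeros of polynomials over to the Gaussian measure.\<close>

lemma AE_std_gaussian_iff:
  fixes P :: "real^'n \<Rightarrow> bool"
  shows "(AE x in std_gaussian. P x) \<longleftrightarrow> (AE x in lborel. P x)"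
  unfolding std_gaussian_eq_density
  by (subst AE_density) (auto simp: normal_density_pos prod_pos)

lemma measure_std_gaussian_open_pos:
  fixes S :: "(real^'n) set"
  assumes "open S" and "S \<noteq> {}"
  shows "0 < measure std_gaussian S"
proof -
  interpret prob_space "std_gaussian :: (real^'n) measure"
    by (rule prob_space_std_gaussian)
  have [measurable]: "S \<in> sets borel"
    using assms(1) by simp
  have "measure std_gaussian S \<noteq> 0"
  proof
    assume "measure std_gaussian S = 0"
    then have "AE x in std_gaussian. x \<notin> S"
      by (subst (asm) prob_eq_0) auto
    then have "S \<in> null_sets lborel"
      unfolding AE_std_gaussian_iff by (subst (asm) AE_iff_null_sets[symmetric]) auto
    then have "negligible S"
      unfolding negligible_iff_null_sets by (rule null_sets_completionI)
    then show False
      using assms open_not_negligible by blast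
  qed
  then show ?thesis
    using measure_nonneg[of "std_gaussian :: (real^'n) measure" S] by linarith
qed

lemma diag_mult_vec: "diag v *v x = (\<chi> i. v $ i * x $ i)"
  by (simp add: diag_def matrix_vector_mult_def vec_eq_iff if_distrib if_distribR sum.delta cong: if_cong)

lemma det_diag: "det (diag v) = (\<Prod>i\<in>UNIV. v $ i)"
  by (subst det_diagonal) (auto simp: diag_def)

lemma diag_mult_diag: "diag u ** diag v = diag (\<chi> i. u $ i * v $ i)"
  by (rule matrix_eq[THEN iffD2]) (simp add: diag_mult_vec matrix_vector_mul_assoc[symmetric] mult.assoc)

lemma matrix_inv_diag:
  assumes "\<And>i. v $ i \<noteq> 0"
  shows "matrix_inv (diag v) = diag (\<chi> i. 1 / v $ i)"
  using assms by (intro matrix_inv_eqI, subst diag_mult_diag) (simp add: diag_def mat_def vec_eq_iff)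

lemma measurable_matrix_vector_mult [measurable]:
  fixes A :: "real^'n^'m"
  shows "(*v) A \<in> borel_measurable borel"
  by (intro borel_measurable_continuous_onI linear_continuous_on matrix_vector_mul_bounded_linear)

text \<open>Change of variables along \<open>h\<close>: the Jacobian \<open>J\<close>, a product of
  absolute values, cancels against the square root of the determinant in the density. The signs of
  the entries of \<tau> are therefore immaterial.\<close>

lemma gaussian_diag:
  fixes \<mu> \<tau> :: "real^'n"
  assumes \<tau>: "\<And>i. \<tau> $ i \<noteq> 0"
  shows "gaussian \<mu> (diag (\<chi> i. (\<tau> $ i)\<^sup>2)) = distr std_gaussian borel (\<lambda>x. \<mu> + diag \<tau> *v x)"
proof -
  define h where "h = (\<lambda>x. \<mu> + diag \<tau> *v x)"
  define J where "J = (\<Prod>i\<in>UNIV. \<bar>\<tau> $ i\<bar>)"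
  have Basis: "(Basis :: (real^'n) set) = range e" "inj (e :: 'n \<Rightarrow> real^'n)"
    by (auto simp: Basis_vec_def inj_def axis_eq_axis)
  \<comment> \<open>\<open>lborel_affine_euclidean\<close> writes its map as a sum over the basis;
    this identifies that map with \<open>h\<close>.\<close>
  have h: "\<mu> + (\<Sum>b\<in>Basis. ((b \<bullet> \<tau>) * (x \<bullet> b)) *\<^sub>R b) = h x" for x
    unfolding h_def diag_mult_vec Basis(1) sum.reindex[OF Basis(2)]
    by (simp add: vec_eq_iff inner_axis' inner_axis) (simp add: axis_def if_distrib sum.delta cong: if_cong)
  have J: "(\<Prod>b\<in>Basis. \<bar>b \<bullet> \<tau>\<bar>) = J"
    unfolding J_def Basis(1) prod.reindex[OF Basis(2)] by (simp add: inner_axis')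
  have nz: "b \<bullet> \<tau> \<noteq> 0" if "b \<in> Basis" for b
    using that \<tau> by (auto simp: Basis(1) inner_axis')
  have lborel: "lborel = density (distr lborel borel h) (\<lambda>_. ennreal J)"
    using lborel_affine_euclidean[of "\<lambda>b. b \<bullet> \<tau>" \<mu>] nz
    unfolding h J by blast
  have J_pos: "J > 0"
    unfolding J_def using \<tau> by (auto intro!: prod_pos)
  have [measurable]: "h \<in> borel_measurable borel"
    unfolding h_def by measurable
  define f where "f = (\<lambda>(\<mu>::real^'n) A y. ennreal (exp (- quad_form (matrix_inv A) (y - \<mu>) / 2)
                   / sqrt ((2 * pi) ^ CARD('n) * det A)))"
  have [measurable]: "f \<mu> A \<in> borel_measurable borel" for \<mu> A
    unfolding f_def quad_form_def by measurable
  have J_sq: "sqrt (\<Prod>i\<in>UNIV. (\<tau> $ i)\<^sup>2) = J"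
    unfolding J_def by (simp add: prod_power_distrib[symmetric] abs_prod)
  have quad: "quad_form (matrix_inv (diag (\<chi> i. (\<tau> $ i)\<^sup>2))) (h x - \<mu>) = quad_form (matrix_inv (mat 1)) (x - 0)" for x
    using \<tau> unfolding h_def quad_form_def
    by (simp add: matrix_inv_diag matrix_inv_mat_1 diag_mult_vec inner_vec_def power2_eq_square)
  have det: "sqrt ((2 * pi) ^ CARD('n) * det (diag (\<chi> i. (\<tau> $ i)\<^sup>2)))
      = J * sqrt ((2 * pi) ^ CARD('n) * det (mat 1 :: real^'n^'n))"
    by (subst real_sqrt_mult) (simp add: det_diag J_sq)
  have f: "ennreal J * f \<mu> (diag (\<chi> i. (\<tau> $ i)\<^sup>2)) (h x) = f 0 (mat 1) x" for x
    using J_pos unfolding f_def quad det by (simp add: ennreal_mult'[symmetric] del: det_I)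
  have "gaussian \<mu> (diag (\<chi> i. (\<tau> $ i)\<^sup>2)) = density lborel (f \<mu> (diag (\<chi> i. (\<tau> $ i)\<^sup>2)))"
    by (simp add: gaussian_def f_def)
  also have "\<dots> = density (distr lborel borel h) (\<lambda>x. ennreal J * f \<mu> (diag (\<chi> i. (\<tau> $ i)\<^sup>2)) x)"
    by (subst lborel) (simp add: density_density_eq)
  also have "\<dots> = distr (density lborel (\<lambda>x. ennreal J * f \<mu> (diag (\<chi> i. (\<tau> $ i)\<^sup>2)) (h x))) borel h"
    by (subst density_distr) auto
  also have "\<dots> = distr std_gaussian borel h"
    unfolding f std_gaussian_def gaussian_def by (simp add: f_def)
  finally show ?thesis
    unfolding h_def .
qed

subsection \<open>Scale-invariant rational statistics\<close>

lemma diag_mult_axis: "diag v *v axis i c = axis i (v $ i * c)"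
  by (simp add: diag_mult_vec vec_eq_iff axis_def)

lemma real_polynomial_function_matrix_vector_mult:
  fixes A :: "real^'n^'m"
  assumes "real_polynomial_function p"
  shows "real_polynomial_function (\<lambda>x. p (A *v x))"
  using real_polynomial_function_compose[OF polynomial_function_bounded_linear[OF matrix_vector_mul_bounded_linear] assms]
  by (simp add: o_def)

text \<open>Where \<open>D\<close> vanishes, \<open>x / 0 = 0\<close> agrees with the convention that a test statistic is \<open>0\<close> on its
  singular set. \<open>J\<close> plays the role of \<open>I\<^sub>1\<close>, \<open>T (e i)\<close> that of \<open>T(\<mu>\<^sub>0 + e\<^sub>i)\<close>.\<close>

locale rational_statistic =
  fixes T N D :: "real^'n \<Rightarrow> real" and J :: "'n set"
  assumes poly_N: "real_polynomial_function N"
    and poly_D: "real_polynomial_function D"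
    and T_eq: "T z = N z / D z"
    and T_scale: "0 < c \<Longrightarrow> T (c *\<^sub>R z) = T z"
    and T_cong: "(\<And>i. i \<in> J \<Longrightarrow> y $ i = z $ i) \<Longrightarrow> T y = T z"
    and D_axis: "i \<in> J \<Longrightarrow> D (e i) \<noteq> 0"
    and J_nonempty: "J \<noteq> {}"
    and T_nonneg: "0 \<le> T z"
    and T_unbounded: "\<exists>z. C < T z"
begin

text \<open>Taking an image of the standard Gaussian makes sense also when entries of \<tau> vanish,
  where the covariance matrix is singular and a Lebesgue density no longer exists.\<close>

definition tail :: "real \<Rightarrow> real^'n \<Rightarrow> real" where
  "tail C \<tau> = measure std_gaussian {g. C \<le> T (diag \<tau> *v g)}"

definition scales :: "(real^'n) set" where
  "scales = {\<tau>. (\<forall>i. \<tau> $ i \<noteq> 0) \<and> (\<Sum>i\<in>UNIV. (\<tau> $ i)\<^sup>2) = 1}"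

text \<open>By invariance only the scales with index in \<open>J\<close> matter, and only up to a common factor.
  Normalizing them yields a compact set, which also contains the degenerate limits.\<close>

definition reduced_scales :: "(real^'n) set" where
  "reduced_scales = {\<tau>. (\<Sum>i\<in>J. (\<tau> $ i)\<^sup>2) = 1 \<and> (\<forall>i. i \<notin> J \<longrightarrow> \<tau> $ i = 0)}"

text \<open>Counterpart of \<open>test_size\<close>: translation and scale invariance make the
  suprema over the mean and over the error variance redundant.\<close>

definition rejection_size :: "real \<Rightarrow> real" where
  "rejection_size C = (SUP \<tau>\<in>scales. tail C \<tau>)"

text \<open>Counterpart of \<open>C_star\<close>. Above this level even the degenerate limiting laws
  of the statistic have no atoms.\<close>

definition concentration_level :: real where
  "concentration_level = Max ((\<lambda>i. T (e i)) ` J)"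

sublocale prob_space "std_gaussian :: (real^'n) measure"
  by (rule prob_space_std_gaussian)

lemma T_measurable [measurable]: "T \<in> borel_measurable borel"
proof -
  have [measurable]: "N \<in> borel_measurable borel" "D \<in> borel_measurable borel"
    using poly_N poly_D by (auto intro: measurable_real_polynomial_function)
  show ?thesis
    unfolding T_eq[abs_def] by measurable
qed

section \<open>Almost sure avoidance of the poles and of a given level\<close>

lemma T_neq_0D: "T z \<noteq> 0 \<Longrightarrow> D z \<noteq> 0"
  by (auto simp: T_eq)

lemma AE_D_neq_0:
  assumes "D (diag \<tau> *v g\<^sub>0) \<noteq> 0"
  shows "AE g in std_gaussian. D (diag \<tau> *v g) \<noteq> 0"
  unfolding AE_std_gaussian_iff
  using real_polynomial_function_matrix_vector_mult[OF poly_D] assms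
  by (rule AE_real_polynomial_function_neq_0)

text \<open>The level set of \<open>T\<close> at \<open>C\<close> is contained in the zeros of
  \<open>D\<close> together with those of the polynomial \<open>N - C * D\<close>. A single point in
  the range of \<open>diag \<tau>\<close> off both zero sets makes the preimage null.\<close>

lemma AE_T_neq:
  assumes "D (diag \<tau> *v g\<^sub>0) \<noteq> 0" and "T (diag \<tau> *v g\<^sub>0) \<noteq> C"
  shows "AE g in std_gaussian. T (diag \<tau> *v g) \<noteq> C"
proof -
  have "real_polynomial_function (\<lambda>z. N z - C * D z)"
    by (intro real_polynomial_function_diff real_polynomial_function.intros(2,4) poly_N poly_D)
  from real_polynomial_function_matrix_vector_mult[OF this]
  have "AE g in std_gaussian. N (diag \<tau> *v g) - C * D (diag \<tau> *v g) \<noteq> 0"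
    unfolding AE_std_gaussian_iff
    by (rule AE_real_polynomial_function_neq_0[where a = g\<^sub>0]) (use assms in \<open>simp add: T_eq field_simps\<close>)
  with AE_D_neq_0[OF assms(1)] show ?thesis
    by eventually_elim (auto simp: T_eq field_simps)
qed

lemma scales_surjE:
  assumes "\<tau> \<in> scales"
  obtains g where "z = diag \<tau> *v g"
proof
  show "z = diag \<tau> *v (\<chi> i. z $ i / \<tau> $ i)"
    using assms by (simp add: scales_def diag_mult_vec vec_eq_iff)
qed

text \<open>The squares over \<open>J\<close> sum to one, so some scale with index in
  \<open>J\<close> is nonzero and its axis lies in the range of \<open>diag \<tau>\<close>. This
  supplies a test point at which \<open>D\<close> does not vanish, however degenerate \<tau>
  is.\<close>

lemma reduced_scales_axisE:
  assumes "\<tau> \<in> reduced_scales"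
  obtains i g where "i \<in> J" and "e i = diag \<tau> *v g"
proof -
  have "\<exists>i\<in>J. \<tau> $ i \<noteq> 0"
  proof (rule ccontr)
    assume "\<not> ?thesis"
    then have "(\<Sum>i\<in>J. (\<tau> $ i)\<^sup>2) = 0"
      by simp
    with assms show False
      by (simp add: reduced_scales_def)
  qed
  then obtain i where i: "i \<in> J" "\<tau> $ i \<noteq> 0"
    by blast
  then have "e i = diag \<tau> *v axis i (1 / \<tau> $ i)"
    by (simp add: diag_mult_axis)
  with i that show thesis
    by blast
qed

lemma T_axis_le: "i \<in> J \<Longrightarrow> T (e i) \<le> concentration_level"
  unfolding concentration_level_def by (intro Max_ge) auto

lemma AE_scales:
  assumes "\<tau> \<in> scales"
  shows "AE g in std_gaussian. D (diag \<tau> *v g) \<noteq> 0" and "AE g in std_gaussian. T (diag \<tau> *v g) \<noteq> C"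
proof -
  \<comment> \<open>Exceeding \<open>C\<close> keeps the value off the level \<open>C\<close>;
    exceeding 0 forces \<open>D z\<close> to be nonzero, because a quotient by 0 is 0.\<close>
  obtain z where z: "max 0 C < T z"
    using T_unbounded by blast
  obtain g where g: "z = diag \<tau> *v g"
    using assms by (rule scales_surjE)
  have D: "D (diag \<tau> *v g) \<noteq> 0" and T: "T (diag \<tau> *v g) \<noteq> C"
    using z T_neq_0D[of z] unfolding g by auto
  show "AE g in std_gaussian. D (diag \<tau> *v g) \<noteq> 0"
    using D by (rule AE_D_neq_0)
  show "AE g in std_gaussian. T (diag \<tau> *v g) \<noteq> C"
    using D T by (rule AE_T_neq)
qed

text \<open>The test point is an axis vector, where the value of \<open>T\<close> is at most
  \<open>concentration_level\<close> and hence differs from any larger \<open>C\<close>.\<close>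

lemma AE_reduced_scales:
  assumes "\<tau> \<in> reduced_scales"
  shows "AE g in std_gaussian. D (diag \<tau> *v g) \<noteq> 0"
    and "concentration_level < C \<Longrightarrow> AE g in std_gaussian. T (diag \<tau> *v g) \<noteq> C"
proof -
  obtain i g where i: "i \<in> J" and g: "e i = diag \<tau> *v g"
    using assms by (rule reduced_scales_axisE)
  have D: "D (diag \<tau> *v g) \<noteq> 0"
    using D_axis[OF i] unfolding g .
  then show "AE g in std_gaussian. D (diag \<tau> *v g) \<noteq> 0"
    by (rule AE_D_neq_0)
  show "AE g in std_gaussian. T (diag \<tau> *v g) \<noteq> C" if "concentration_level < C"
    using D by (rule AE_T_neq) (use that T_axis_le[OF i] in \<open>simp add: g\<close>)
qed

section \<open>Continuity of rejection probabilities in scales and critical value\<close>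

lemma tendsto_T:
  assumes "(z \<longlongrightarrow> z\<^sub>0) F" and "D z\<^sub>0 \<noteq> 0"
  shows "((\<lambda>x. T (z x)) \<longlongrightarrow> T z\<^sub>0) F"
proof -
  have "isCont N z\<^sub>0" "isCont D z\<^sub>0"
    using continuous_on_real_polynomial_function[OF poly_N, of UNIV]
      continuous_on_real_polynomial_function[OF poly_D, of UNIV]
    by (simp_all add: continuous_on_eq_continuous_at)
  then show ?thesis
    unfolding T_eq using assms(2) by (intro tendsto_divide isCont_tendsto_compose[OF _ assms(1)])
qed

text \<open>Dominated convergence for the indicators of the rejection regions. Almost surely the
  statistic converges to a limit different from \<open>C\<^sub>0\<close>, so membership in the
  region is eventually constant.\<close>

lemma tail_tendsto:
  assumes \<tau>: "\<tau> \<longlonglongrightarrow> \<tau>\<^sub>0" and C: "C \<longlonglongrightarrow> C\<^sub>0"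
    and D: "AE g in std_gaussian. D (diag \<tau>\<^sub>0 *v g) \<noteq> 0"
    and T: "AE g in std_gaussian. T (diag \<tau>\<^sub>0 *v g) \<noteq> C\<^sub>0"
  shows "(\<lambda>m. tail (C m) (\<tau> m)) \<longlonglongrightarrow> tail C\<^sub>0 \<tau>\<^sub>0"
proof -
  define A where "A = (\<lambda>C \<tau>. {g. C \<le> T (diag \<tau> *v g)})"
  have [measurable]: "A C \<tau> \<in> sets borel" for C \<tau>
    unfolding A_def by measurable
  have "AE g in std_gaussian. (\<lambda>m. indicator (A (C m) (\<tau> m)) g :: real) \<longlonglongrightarrow> indicator (A C\<^sub>0 \<tau>\<^sub>0) g"
    using D T
  proof eventually_elim
    case (elim g)
    have "(\<lambda>m. diag (\<tau> m) *v g) \<longlonglongrightarrow> diag \<tau>\<^sub>0 *v g"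
      unfolding diag_mult_vec using \<tau> by (intro vec_tendstoI) (auto intro!: tendsto_intros)
    then have "(\<lambda>m. T (diag (\<tau> m) *v g)) \<longlonglongrightarrow> T (diag \<tau>\<^sub>0 *v g)"
      using elim(1) by (rule tendsto_T)
    from tendsto_diff[OF this C]
    have lim: "(\<lambda>m. T (diag (\<tau> m) *v g) - C m) \<longlonglongrightarrow> T (diag \<tau>\<^sub>0 *v g) - C\<^sub>0" .
    have "\<forall>\<^sub>F m in sequentially. g \<in> A (C m) (\<tau> m) \<longleftrightarrow> g \<in> A C\<^sub>0 \<tau>\<^sub>0"
    proof (cases "C\<^sub>0 < T (diag \<tau>\<^sub>0 *v g)")
      case True
      then have "\<forall>\<^sub>F m in sequentially. 0 < T (diag (\<tau> m) *v g) - C m"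
        using order_tendstoD(1)[OF lim, of 0] by simp
      then show ?thesis
        by eventually_elim (use True in \<open>simp add: A_def\<close>)
    next
      case False
      then have "\<forall>\<^sub>F m in sequentially. T (diag (\<tau> m) *v g) - C m < 0"
        using order_tendstoD(2)[OF lim, of 0] elim(2) by simp
      then show ?thesis
        by eventually_elim (use False elim(2) in \<open>simp add: A_def\<close>)
    qed
    then have "\<forall>\<^sub>F m in sequentially. (indicator (A (C m) (\<tau> m)) g :: real) = indicator (A C\<^sub>0 \<tau>\<^sub>0) g"
      by eventually_elim (simp add: indicator_def)
    then show ?case
      by (rule tendsto_eventually)
  qed
  then have "(\<lambda>m. \<integral>g. indicator (A (C m) (\<tau> m)) g \<partial>std_gaussian) \<longlonglongrightarrow> (\<integral>g. indicator (A C\<^sub>0 \<tau>\<^sub>0) g \<partial>std_gaussian :: real)"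
    by (intro integral_dominated_convergence[where w = "\<lambda>_. 1"]) (auto simp: indicator_def)
  then show ?thesis
    by (simp add: tail_def A_def)
qed

section \<open>Bounds and monotonicity of the size\<close>

lemma tail_le_1: "tail C \<tau> \<le> 1"
  by (simp add: tail_def)

lemma tail_antimono: "C \<le> C' \<Longrightarrow> tail C' \<tau> \<le> tail C \<tau>"
  unfolding tail_def by (intro finite_measure_mono) auto

lemma tail_nonpos: "C \<le> 0 \<Longrightarrow> tail C \<tau> = 1"
proof -
  assume "C \<le> 0"
  then have "{g. C \<le> T (diag \<tau> *v g)} = UNIV"
    using T_nonneg by (auto intro: order_trans)
  then show ?thesis
    using prob_space by (simp add: tail_def)
qed

lemma scales_nonempty: "scales \<noteq> {}"
proof -
  have "(\<chi> i. 1 / sqrt CARD('n)) \<in> (scales :: (real^'n) set)"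
    by (simp add: scales_def power_divide)
  then show ?thesis
    by blast
qed

lemma bdd_above_tail: "bdd_above (tail C ` S)"
  using tail_le_1 by (auto simp: bdd_above_def)

lemma tail_le_rejection_size: "\<tau> \<in> scales \<Longrightarrow> tail C \<tau> \<le> rejection_size C"
  unfolding rejection_size_def by (intro cSUP_upper bdd_above_tail)

lemma rejection_size_leI: "(\<And>\<tau>. \<tau> \<in> scales \<Longrightarrow> tail C \<tau> \<le> a) \<Longrightarrow> rejection_size C \<le> a"
  unfolding rejection_size_def by (intro cSUP_least scales_nonempty)

lemma less_rejection_sizeE:
  assumes "a < rejection_size C"
  obtains \<tau> where "\<tau> \<in> scales" and "a < tail C \<tau>"
  using assms less_cSUP_iff[OF scales_nonempty bdd_above_tail] unfolding rejection_size_def by blast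

lemma rejection_size_le_1: "rejection_size C \<le> 1"
  by (intro rejection_size_leI tail_le_1)

lemma rejection_size_antimono: "C \<le> C' \<Longrightarrow> rejection_size C' \<le> rejection_size C"
  by (intro rejection_size_leI order_trans[OF tail_antimono tail_le_rejection_size])

lemma rejection_size_nonpos: "C \<le> 0 \<Longrightarrow> rejection_size C = 1"
  unfolding rejection_size_def using scales_nonempty by (simp add: tail_nonpos)

text \<open>For a nondegenerate scale the event that the statistic exceeds \<open>max 0 C\<close> is
  open and, by unboundedness, nonempty, so it has positive Gaussian measure.\<close>

lemma rejection_size_pos: "0 < rejection_size C"
proof -
  obtain \<tau> where \<tau>: "\<tau> \<in> scales"
    using scales_nonempty by blast
  obtain z where z: "max 0 C < T z"
    using T_unbounded by blast
  obtain g where g: "z = diag \<tau> *v g"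
    using \<tau> by (rule scales_surjE)
  \<comment> \<open>Multiplying by the square of the denominator turns the event into a strict
    polynomial inequality, which is visibly open. Where \<open>D\<close> vanishes it reads 0 < 0;
    the matching event for \<open>T\<close> is also false there because the threshold is
    nonnegative.\<close>
  define S where "S = {g. max 0 C * (D (diag \<tau> *v g))\<^sup>2 < N (diag \<tau> *v g) * D (diag \<tau> *v g)}"
  have "continuous_on UNIV (\<lambda>g. N (diag \<tau> *v g))" "continuous_on UNIV (\<lambda>g. D (diag \<tau> *v g))"
    by (intro continuous_on_real_polynomial_function real_polynomial_function_matrix_vector_mult
        poly_N poly_D)+
  then have "open S"
    unfolding S_def by (intro open_Collect_less continuous_intros)
  moreover have *: "h \<in> S \<longleftrightarrow> max 0 C < T (diag \<tau> *v h)" for h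
  proof (cases "D (diag \<tau> *v h) = 0")
    case False
    then have "0 < (D (diag \<tau> *v h))\<^sup>2"
      by simp
    then have "max 0 C < T (diag \<tau> *v h) \<longleftrightarrow>
        max 0 C * (D (diag \<tau> *v h))\<^sup>2 < T (diag \<tau> *v h) * (D (diag \<tau> *v h))\<^sup>2"
      by simp
    also have "T (diag \<tau> *v h) * (D (diag \<tau> *v h))\<^sup>2 = N (diag \<tau> *v h) * D (diag \<tau> *v h)"
      using False by (simp add: T_eq power2_eq_square)
    finally show ?thesis
      by (simp add: S_def)
  qed (auto simp: S_def T_eq)
  then have "S \<noteq> {}"
    using z g by blast
  ultimately have "0 < measure std_gaussian S"
    by (rule measure_std_gaussian_open_pos)
  also have "\<dots> \<le> tail C \<tau>"
    unfolding tail_def by (intro finite_measure_mono) (auto simp: *)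
  also have "\<dots> \<le> rejection_size C"
    using \<tau> by (rule tail_le_rejection_size)
  finally show ?thesis .
qed

text \<open>For nondegenerate scales the statistic has no atoms, so that the size is continuous from the
  right.\<close>

lemma rejection_size_leI_right:
  assumes "\<And>C'. C < C' \<Longrightarrow> rejection_size C' \<le> a"
  shows "rejection_size C \<le> a"
proof (rule rejection_size_leI)
  fix \<tau> assume \<tau>: "\<tau> \<in> scales"
  have "(\<lambda>m. C + inverse (real (Suc m))) \<longlonglongrightarrow> C + 0"
    by (intro tendsto_add tendsto_const LIMSEQ_inverse_real_of_nat)
  then have "(\<lambda>m. tail (C + inverse (real (Suc m))) \<tau>) \<longlonglongrightarrow> tail C \<tau>"
    using AE_scales[OF \<tau>] by (intro tail_tendsto[OF tendsto_const]) simp_all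
  moreover have "tail (C + inverse (real (Suc m))) \<tau> \<le> a" for m
    using tail_le_rejection_size[OF \<tau>] assms[of "C + inverse (real (Suc m))"] order_trans by fastforce
  ultimately show "tail C \<tau> \<le> a"
    by (intro LIMSEQ_le_const2) auto
qed

text \<open>Zeroing the scales outside \<open>J\<close> leaves the statistic unchanged by
  \<open>T_cong\<close>, and dividing by the norm \<open>c\<close> of the remaining ones does so by
  \<open>T_scale\<close>. This norm is positive because \<open>J\<close> is nonempty.\<close>

lemma reduce_scales:
  assumes "\<tau> \<in> scales"
  obtains \<tau>' where "\<tau>' \<in> reduced_scales" and "\<And>C. tail C \<tau>' = tail C \<tau>"
proof -
  define c where "c = sqrt (\<Sum>i\<in>J. (\<tau> $ i)\<^sup>2)"
  define \<tau>' where "\<tau>' = (\<chi> i. if i \<in> J then \<tau> $ i / c else 0)"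
  have pos: "0 < (\<Sum>i\<in>J. (\<tau> $ i)\<^sup>2)"
    using assms J_nonempty by (intro sum_pos) (auto simp: scales_def)
  then have c: "0 < c" "c\<^sup>2 = (\<Sum>i\<in>J. (\<tau> $ i)\<^sup>2)"
    by (simp_all add: c_def)
  have "\<tau>' \<in> reduced_scales"
    using c pos by (simp add: reduced_scales_def \<tau>'_def power_divide sum_divide_distrib[symmetric])
  moreover have "T (diag \<tau>' *v g) = T (diag \<tau> *v g)" for g
  proof -
    have "T (diag \<tau>' *v g) = T (c *\<^sub>R (diag \<tau>' *v g))"
      using c by (simp add: T_scale)
    also have "\<dots> = T (diag \<tau> *v g)"
      using c by (intro T_cong) (simp add: diag_mult_vec \<tau>'_def)
    finally show ?thesis .
  qed
  ultimately show thesis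
    using that by (simp add: tail_def)
qed

section \<open>Compactness and degenerate limits\<close>

lemma compact_reduced_scales: "compact reduced_scales"
proof -
  have "reduced_scales \<subseteq> cball 0 1"
  proof
    fix \<tau> assume \<tau>: "\<tau> \<in> reduced_scales"
    then have "(\<Sum>i\<in>UNIV. (\<tau> $ i)\<^sup>2) = (\<Sum>i\<in>J. (\<tau> $ i)\<^sup>2)"
      by (intro sum.mono_neutral_right) (auto simp: reduced_scales_def)
    with \<tau> have "norm \<tau> = 1"
      by (simp add: reduced_scales_def norm_vec_def L2_set_def)
    then show "\<tau> \<in> cball 0 1"
      by simp
  qed
  then have "bounded reduced_scales"
    using bounded_cball bounded_subset by blast
  moreover have "closed {\<tau> :: real^'n. i \<notin> J \<longrightarrow> \<tau> $ i = 0}" for i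
    by (cases "i \<in> J") (auto intro!: closed_Collect_eq continuous_intros)
  then have "closed reduced_scales"
    unfolding reduced_scales_def
    by (intro closed_Collect_conj closed_Collect_all closed_Collect_eq continuous_intros)
  ultimately show ?thesis
    by (simp add: compact_eq_bounded_closed)
qed

text \<open>For each \<open>m\<close> a scale whose tail exceeds \<open>a\<close> is reduced, and
  compactness gives a convergent subsequence. The bound by \<open>rejection_size\<close> is recorded
  as well, since a reduced scale need not belong to \<open>scales\<close>.\<close>

lemma limiting_scaleE:
  assumes "\<And>m. a < rejection_size (C m)"
  obtains \<tau> s \<tau>\<^sub>0 where "strict_mono (s :: nat \<Rightarrow> nat)"
    and "\<tau>\<^sub>0 \<in> reduced_scales" and "(\<tau> \<circ> s) \<longlonglongrightarrow> \<tau>\<^sub>0"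
    and "\<forall>m. a < tail (C m) (\<tau> m)" and "\<forall>m C. tail C (\<tau> m) \<le> rejection_size C"
proof -
  have "\<exists>\<tau>\<in>reduced_scales. a < tail (C m) \<tau> \<and> (\<forall>C. tail C \<tau> \<le> rejection_size C)" for m
  proof -
    obtain \<tau> where \<tau>: "\<tau> \<in> scales" "a < tail (C m) \<tau>"
      using assms[of m] by (rule less_rejection_sizeE)
    from reduce_scales[OF \<tau>(1)] obtain \<tau>' where "\<tau>' \<in> reduced_scales" "\<And>C. tail C \<tau>' = tail C \<tau>"
      by blast
    with \<tau> show ?thesis
      using tail_le_rejection_size[OF \<tau>(1)] by (intro bexI[of _ \<tau>']) simp_all
  qed
  then obtain \<tau> where \<tau>: "\<And>m. \<tau> m \<in> reduced_scales" "\<And>m. a < tail (C m) (\<tau> m)"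
    "\<And>m C. tail C (\<tau> m) \<le> rejection_size C"
    by metis
  obtain \<tau>\<^sub>0 s where "\<tau>\<^sub>0 \<in> reduced_scales" "strict_mono (s :: nat \<Rightarrow> nat)" "(\<tau> \<circ> s) \<longlonglongrightarrow> \<tau>\<^sub>0"
    using seq_compactE[OF compact_imp_seq_compact[OF compact_reduced_scales]] \<tau>(1) by metis
  with \<tau> show thesis
    by (intro that[of s \<tau>\<^sub>0 \<tau>]) simp_all
qed

lemma tail_limit_scale:
  assumes "\<tau>\<^sub>0 \<in> reduced_scales" and "(\<tau> \<circ> s) \<longlonglongrightarrow> \<tau>\<^sub>0" and "C \<longlonglongrightarrow> C\<^sub>0" and "concentration_level < C\<^sub>0"
  shows "(\<lambda>m. tail (C m) (\<tau> (s m))) \<longlonglongrightarrow> tail C\<^sub>0 \<tau>\<^sub>0"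
  using tail_tendsto[OF assms(2,3) AE_reduced_scales[OF assms(1)], OF assms(4)] by simp

text \<open>If the size exceeded \<open>a\<close> at every integer level, a limiting scale would
  give mass at least \<open>a\<close> to all tails above \<open>concentration_level\<close>. Tails
  of a real-valued statistic decrease to zero.\<close>

lemma ex_rejection_size_le:
  assumes "0 < a"
  shows "\<exists>C. rejection_size C \<le> a"
proof (rule ccontr)
  assume "\<not> ?thesis"
  then have "a < rejection_size (real m)" for m
    by (simp add: not_le)
  then obtain \<tau> s \<tau>\<^sub>0 where s: "strict_mono (s :: nat \<Rightarrow> nat)"
    and \<tau>\<^sub>0: "\<tau>\<^sub>0 \<in> reduced_scales" "(\<tau> \<circ> s) \<longlonglongrightarrow> \<tau>\<^sub>0" and a: "\<forall>m. a < tail (real m) (\<tau> m)"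
    and "\<forall>m C. tail C (\<tau> m) \<le> rejection_size C"
    by (rule limiting_scaleE[where C = real])
  have "a \<le> tail C \<tau>\<^sub>0" if "concentration_level < C" for C
  proof (rule LIMSEQ_le_const)
    show "(\<lambda>m. tail C (\<tau> (s m))) \<longlonglongrightarrow> tail C \<tau>\<^sub>0"
      using \<tau>\<^sub>0 tendsto_const that by (rule tail_limit_scale)
    \<comment> \<open>The scale \<open>\<tau> (s m)\<close> was chosen for the level
      \<open>s m\<close>, which is at least \<open>m\<close>; once this passes the fixed
      \<open>C\<close>, monotonicity transfers the bound to \<open>C\<close>.\<close>
    have "a \<le> tail C (\<tau> (s m))" if m: "nat \<lceil>C\<rceil> \<le> m" for m
    proof -
      have "C \<le> real (s m)"
        using m seq_suble[OF s, of m] by linarith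
      from tail_antimono[OF this, of "\<tau> (s m)"] a[rule_format, of "s m"] show ?thesis
        by linarith
    qed
    then show "\<exists>M. \<forall>m\<ge>M. a \<le> tail C (\<tau> (s m))"
      by blast
  qed
  \<comment> \<open>The levels start above \<open>concentration_level\<close> because the bound on
    the limiting tail is available only there.\<close>
  moreover define A where "A = (\<lambda>m. {g. concentration_level + 1 + real m \<le> T (diag \<tau>\<^sub>0 *v g)})"
  have "(\<lambda>m. measure std_gaussian (A m)) \<longlonglongrightarrow> measure std_gaussian (\<Inter>m. A m)"
    unfolding A_def by (rule finite_Lim_measure_decseq) (auto simp: decseq_def)
  moreover have "(\<Inter>m. A m) = {}"
  proof -
    have "\<exists>m. g \<notin> A m" for g
      using reals_Archimedean2[of "T (diag \<tau>\<^sub>0 *v g) - concentration_level - 1"]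
      by (auto simp: A_def not_le algebra_simps)
    then show ?thesis
      by blast
  qed
  ultimately have "a \<le> 0"
    by (intro LIMSEQ_le_const[where X = "\<lambda>m. measure std_gaussian (A m)"]) (auto simp: A_def tail_def)
  with assms show False
    by simp
qed

text \<open>Along the subsequence, the tails at the levels \<open>c (s m)\<close> and those at
  \<open>C\<close> have the same limit \<open>tail C \<tau>\<^sub>0\<close>. The former exceed
  \<open>a\<close> and the latter are at most the size at \<open>C\<close>.\<close>

lemma rejection_size_left:
  assumes "concentration_level < C" and "\<And>C'. C' < C \<Longrightarrow> a < rejection_size C'"
  shows "a \<le> rejection_size C"
proof -
  define c where "c m = C - inverse (real (Suc m))" for m
  have "c \<longlonglongrightarrow> C - 0"
    unfolding c_def by (intro tendsto_diff tendsto_const LIMSEQ_inverse_real_of_nat)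
  then have c: "c \<longlonglongrightarrow> C"
    by simp
  have "a < rejection_size (c m)" for m
    by (intro assms(2)) (simp add: c_def)
  then obtain \<tau> s \<tau>\<^sub>0 where s: "strict_mono (s :: nat \<Rightarrow> nat)"
    and \<tau>\<^sub>0: "\<tau>\<^sub>0 \<in> reduced_scales" "(\<tau> \<circ> s) \<longlonglongrightarrow> \<tau>\<^sub>0" and a: "\<forall>m. a < tail (c m) (\<tau> m)"
    and le: "\<forall>m C. tail C (\<tau> m) \<le> rejection_size C"
    by (rule limiting_scaleE[where C = c])
  have "(\<lambda>m. tail ((c \<circ> s) m) (\<tau> (s m))) \<longlonglongrightarrow> tail C \<tau>\<^sub>0"
    using \<tau>\<^sub>0 LIMSEQ_subseq_LIMSEQ[OF c s] assms(1) by (rule tail_limit_scale)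
  then have "a \<le> tail C \<tau>\<^sub>0"
    by (rule LIMSEQ_le_const) (use a in \<open>auto intro: less_imp_le\<close>)
  moreover have "(\<lambda>m. tail C (\<tau> (s m))) \<longlonglongrightarrow> tail C \<tau>\<^sub>0"
    using \<tau>\<^sub>0 tendsto_const assms(1) by (rule tail_limit_scale)
  then have "tail C \<tau>\<^sub>0 \<le> rejection_size C"
    by (rule LIMSEQ_le_const2) (use le in auto)
  ultimately show ?thesis
    by simp
qed

text \<open>The infimum of the admissible levels is attained by right-continuity. It is finite
  because the size is 1 at every nonpositive level.\<close>

lemma ex_smallest_critical_value:
  assumes "a \<in> {0<..<1}"
  shows "\<exists>C. is_smallest C {C. rejection_size C \<le> a}"
proof -
  define S where "S = {C. rejection_size C \<le> a}"
  have "S \<noteq> {}"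
    unfolding S_def using ex_rejection_size_le[of a] assms by auto
  moreover have "bdd_below S"
  proof (rule bdd_belowI)
    fix C assume "C \<in> S"
    then show "0 \<le> C"
      using assms rejection_size_nonpos[of C] by (force simp: S_def)
  qed
  moreover have "rejection_size (Inf S) \<le> a"
  proof (rule rejection_size_leI_right)
    fix C assume "Inf S < C"
    then obtain C' where "C' \<in> S" "C' < C"
      using cInf_lessD[OF \<open>S \<noteq> {}\<close>] by blast
    then show "rejection_size C \<le> a"
      using rejection_size_antimono[of C' C] by (auto simp: S_def)
  qed
  ultimately show ?thesis
    by (intro exI[of _ "Inf S"]) (auto simp: is_smallest_def S_def[symmetric] cInf_lower, simp add: S_def)
qed

text \<open>Right-continuity identifies the supremum over the open half-line, which defines
  \<open>alpha_star\<close>, with the size at its endpoint.\<close>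

lemma SUP_rejection_size:
  "(SUP C\<in>{concentration_level<..}. rejection_size C) = rejection_size concentration_level"
proof (rule antisym)
  show "(SUP C\<in>{concentration_level<..}. rejection_size C) \<le> rejection_size concentration_level"
    by (intro cSUP_least) (auto intro: rejection_size_antimono)
  show "rejection_size concentration_level \<le> (SUP C\<in>{concentration_level<..}. rejection_size C)"
    by (rule rejection_size_leI_right, rule cSUP_upper)
       (use rejection_size_le_1 in \<open>auto simp: bdd_above_def\<close>)
qed

text \<open>The smallest critical value already gives equality: by monotonicity if it is at most
  \<open>concentration_level\<close>, and otherwise from the left, since all smaller levels have
  size above \<open>a\<close>.\<close>

lemma ex_rejection_size_eq:
  assumes "a \<in> {0<..<1}" and "a \<le> rejection_size concentration_level"
  shows "\<exists>C. rejection_size C = a"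
proof -
  obtain C where C: "rejection_size C \<le> a" and min: "\<And>C'. rejection_size C' \<le> a \<Longrightarrow> C \<le> C'"
    using ex_smallest_critical_value[OF assms(1)] by (auto simp: is_smallest_def)
  have "a \<le> rejection_size C"
  proof (cases "C \<le> concentration_level")
    case True
    then show ?thesis
      using assms(2) rejection_size_antimono order_trans by blast
  next
    case False
    moreover have "a < rejection_size C'" if "C' < C" for C'
      using min[of C'] that by linarith
    ultimately show ?thesis
      by (intro rejection_size_left) simp_all
  qed
  with C show ?thesis
    by (intro exI[of _ C]) simp
qed

end

subsection \<open>Weighted Gram matrices\<close>

lemma matrix_inv_right:
  fixes A :: "real^'n^'n"
  assumes "det A \<noteq> 0"
  shows "A ** matrix_inv A = mat 1"
proof -
  obtain B where "A ** B = mat 1"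
    using assms by (auto simp: invertible_det_nz[symmetric] invertible_def)
  then show ?thesis
    using matrix_inv_eqI by blast
qed

lemma matrix_inv_left:
  fixes A :: "real^'n^'n"
  assumes "det A \<noteq> 0"
  shows "matrix_inv A ** A = mat 1"
  using matrix_inv_right[OF assms] matrix_left_right_inverse by blast

lemma det_neq_0_iff_kernel:
  fixes A :: "real^'n^'n"
  shows "det A \<noteq> 0 \<longleftrightarrow> (\<forall>x. A *v x = 0 \<longrightarrow> x = 0)"
  by (simp add: invertible_det_nz[symmetric] invertible_left_inverse matrix_left_invertible_ker)

lemma transpose_matrix_inv:
  fixes A :: "real^'n^'n"
  assumes "det A \<noteq> 0"
  shows "transpose (matrix_inv A) = matrix_inv (transpose A)"
  by (rule matrix_inv_eqI[symmetric])
     (simp add: matrix_transpose_mul[symmetric] matrix_inv_left[OF assms])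

lemma inner_matrix_vector_mult:
  fixes A :: "real^'n^'m"
  shows "x \<bullet> (A *v y) = (transpose A *v x) \<bullet> y"
  by (simp add: dot_lmul_matrix[symmetric])

lemma matrix_inv_scaleR:
  fixes A :: "real^'n^'n"
  assumes "det A \<noteq> 0" and "c \<noteq> 0"
  shows "matrix_inv (c *\<^sub>R A) = (1 / c) *\<^sub>R matrix_inv A"
proof (rule matrix_inv_eqI)
  show "(c *\<^sub>R A) ** ((1 / c) *\<^sub>R matrix_inv A) = mat 1"
    using assms(2)
    by (simp add: matrix_eq matrix_vector_mul_assoc[symmetric] scaleR_matrix_vector_assoc[symmetric]
        matrix_vector_mult_scaleR)
       (simp add: matrix_vector_mul_assoc matrix_inv_right[OF assms(1)])
qed

lemma det_scaleR_neq_0_iff: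
  fixes A :: "real^'n^'n"
  assumes "c \<noteq> 0"
  shows "det (c *\<^sub>R A) \<noteq> 0 \<longleftrightarrow> det A \<noteq> 0"
  using assms by (simp add: det_neq_0_iff_kernel scaleR_matrix_vector_assoc[symmetric])

text \<open>Cramer's rule exhibits the form as a quotient of polynomials in the entries of
  \<open>A\<close> and \<open>v\<close>, the shape required by
  \<open>rational_statistic\<close>.\<close>

lemma quad_form_matrix_inv_cramer:
  fixes A :: "real^'n^'n"
  assumes "det A \<noteq> 0"
  shows "quad_form (matrix_inv A) v =
    (\<Sum>k\<in>UNIV. v $ k * det (\<chi> i j. if j = k then v $ i else A $ i $ j)) / det A"
proof -
  have "A *v (matrix_inv A *v v) = v"
    by (simp add: matrix_vector_mul_assoc matrix_inv_right[OF assms])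
  then have "matrix_inv A *v v = (\<chi> k. det (\<chi> i j. if j = k then v $ i else A $ i $ j) / det A)"
    using cramer[OF assms] by blast
  then show ?thesis
    unfolding quad_form_def by (simp add: inner_vec_def sum_divide_distrib)
qed

lemma inner_weighted_gram:
  fixes B :: "real^'n^'q"
  shows "x \<bullet> ((B ** diag w ** transpose B) *v x) = (\<Sum>i\<in>UNIV. w $ i * ((transpose B *v x) $ i)\<^sup>2)"
proof -
  have "x \<bullet> ((B ** diag w ** transpose B) *v x) = x \<bullet> (B *v (diag w *v (transpose B *v x)))"
    by (simp only: matrix_vector_mul_assoc matrix_mul_assoc)
  also have "\<dots> = (transpose B *v x) \<bullet> (diag w *v (transpose B *v x))"
    by (rule inner_matrix_vector_mult)
  finally show ?thesis
    by (simp add: diag_mult_vec inner_vec_def power2_eq_square mult_ac del: transpose_matrix_vector)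
qed

lemma weighted_gram_isotropic:
  fixes B :: "real^'n^'q"
  assumes "\<And>i. 0 \<le> w $ i" and "x \<bullet> ((B ** diag w ** transpose B) *v x) = 0"
  shows "diag w *v (transpose B *v x) = 0"
proof -
  have "\<forall>i\<in>UNIV. w $ i * ((transpose B *v x) $ i)\<^sup>2 = 0"
    using assms unfolding inner_weighted_gram
    by (subst sum_nonneg_eq_0_iff[symmetric]) auto
  then show ?thesis
    by (auto simp: diag_mult_vec vec_eq_iff)
qed

text \<open>Substituting \<open>v = S *v x\<close> turns the form into
  \<open>x \<bullet> (S *v x)\<close>, a nonnegative sum. If it vanished, so would
  \<open>S *v x\<close>, contradicting \<open>v \<noteq> 0\<close>.\<close>

lemma quad_form_weighted_gram_pos:
  fixes B :: "real^'n^'q"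
  assumes w: "\<And>i. 0 \<le> w $ i" and det: "det (B ** diag w ** transpose B) \<noteq> 0" and v: "v \<noteq> 0"
  shows "0 < quad_form (matrix_inv (B ** diag w ** transpose B)) v"
proof -
  define S where "S = B ** diag w ** transpose B"
  define x where "x = matrix_inv S *v v"
  have v_eq: "v = S *v x"
    using matrix_inv_right[OF det] by (simp add: x_def S_def matrix_vector_mul_assoc)
  have "quad_form (matrix_inv S) v = x \<bullet> (S *v x)"
    unfolding quad_form_def x_def[symmetric] v_eq[symmetric] by (rule inner_commute)
  moreover have "0 \<le> x \<bullet> (S *v x)"
    unfolding S_def inner_weighted_gram using w by (intro sum_nonneg) simp
  moreover have "x \<bullet> (S *v x) \<noteq> 0"
  proof
    assume "x \<bullet> (S *v x) = 0"
    with w have "diag w *v (transpose B *v x) = 0"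
      unfolding S_def by (rule weighted_gram_isotropic)
    then have "S *v x = 0"
      by (simp add: S_def matrix_vector_mul_assoc[symmetric] del: transpose_matrix_vector)
    with v v_eq show False
      by simp
  qed
  ultimately show ?thesis
    by (simp add: S_def)
qed

text \<open>With positive weights a kernel vector is annihilated by the transpose of
  \<open>B\<close>, which is injective by full row rank.\<close>

lemma det_weighted_gram_neq_0:
  fixes B :: "real^'n^'q"
  assumes "rank B = CARD('q)" and "\<And>i. 0 < w $ i"
  shows "det (B ** diag w ** transpose B) \<noteq> 0"
  unfolding det_neq_0_iff_kernel
proof (intro allI impI)
  fix x assume "(B ** diag w ** transpose B) *v x = 0"
  then have "diag w *v (transpose B *v x) = 0"
    using assms(2) by (intro weighted_gram_isotropic) (auto intro: less_imp_le)
  then have "transpose B *v x = 0"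
    using assms(2) by (simp add: diag_mult_vec vec_eq_iff less_imp_neq[symmetric] del: transpose_matrix_vector)
  moreover have "inj ((*v) (transpose B))"
    using assms(1) by (simp add: full_rank_injective[symmetric] rank_transpose)
  ultimately show "x = 0"
    by (metis injD matrix_vector_mult_0_right)
qed

lemma span_axis: "span (range (e :: 'n \<Rightarrow> real^'n)) = UNIV"
proof -
  have "Basis \<subseteq> range (e :: 'n \<Rightarrow> real^'n)"
    by (auto simp: Basis_vec_def)
  then show ?thesis
    using span_mono span_Basis by blast
qed

section \<open>Polynomial dependence of determinants and Gram matrices\<close>

lemma real_polynomial_function_vec_nth_linear:
  "linear f \<Longrightarrow> real_polynomial_function (\<lambda>x. f x $ i)" for f :: "real^'n \<Rightarrow> real^'m"
  by (intro real_polynomial_function.intros(1) bounded_linear_compose[OF bounded_linear_vec_nth] linear_conv_bounded_linear[THEN iffD1])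

lemma real_polynomial_function_det:
  fixes M :: "real^'n \<Rightarrow> real^'q^'q"
  assumes "\<And>i j. real_polynomial_function (\<lambda>x. M x $ i $ j)"
  shows "real_polynomial_function (\<lambda>x. det (M x))"
  unfolding det_def
  by (intro real_polynomial_function_sum real_polynomial_function_prod real_polynomial_function.intros(2,4)
      finite_permutations finite assms)

lemma real_polynomial_function_weighted_gram:
  fixes B :: "real^'n^'q"
  assumes "\<And>i. real_polynomial_function (\<lambda>x. w x $ i)"
  shows "real_polynomial_function (\<lambda>x. (B ** diag (w x) ** transpose B) $ i $ j)"
proof -
  have "(B ** diag (w x) ** transpose B) $ i $ j = (\<Sum>k\<in>UNIV. B $ i $ k * w x $ k * B $ j $ k)" for x
    by (simp add: matrix_matrix_mult_def diag_def transpose_def if_distrib sum.delta cong: if_cong)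
  then show ?thesis
    using assms by (simp only:) (intro real_polynomial_function_sum real_polynomial_function.intros(2,4) finite)
qed

section \<open>Sizes of tests under the heteroskedasticity model\<close>

context rational_statistic
begin

text \<open>\<open>T\<close> is \<open>T'\<close> recentered at \<mu>. The variance factor is
  absorbed into the scales as its square root and then disappears by scale invariance.\<close>

lemma rej_prob_eq_tail:
  assumes T': "\<And>z. T' (\<mu> + z) = T z" and \<sigma>2: "0 < \<sigma>2" and \<tau>: "\<And>i. \<tau> $ i \<noteq> 0"
  shows "rej_prob T' C \<mu> (\<sigma>2 *\<^sub>R diag (\<chi> i. (\<tau> $ i)\<^sup>2)) = tail C \<tau>"
proof -
  have "\<sigma>2 *\<^sub>R diag (\<chi> i. (\<tau> $ i)\<^sup>2) = diag (\<chi> i. ((sqrt \<sigma>2 *\<^sub>R \<tau>) $ i)\<^sup>2)"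
    using \<sigma>2 by (simp add: diag_def vec_eq_iff power_mult_distrib)
  moreover have "(sqrt \<sigma>2 *\<^sub>R \<tau>) $ i \<noteq> 0" for i
    using \<sigma>2 \<tau> by simp
  ultimately have "gaussian \<mu> (\<sigma>2 *\<^sub>R diag (\<chi> i. (\<tau> $ i)\<^sup>2))
      = distr std_gaussian borel (\<lambda>g. \<mu> + diag (sqrt \<sigma>2 *\<^sub>R \<tau>) *v g)"
    using gaussian_diag[of "sqrt \<sigma>2 *\<^sub>R \<tau>" \<mu>] by simp
  moreover have "T' = (\<lambda>y. T (y - \<mu>))"
    using T' by (metis add.commute diff_add_cancel)
  then have [measurable]: "T' \<in> borel_measurable borel"
    by simp
  moreover have "T' (\<mu> + diag (sqrt \<sigma>2 *\<^sub>R \<tau>) *v g) = T (diag \<tau> *v g)" for g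
  proof -
    have "diag (sqrt \<sigma>2 *\<^sub>R \<tau>) *v g = sqrt \<sigma>2 *\<^sub>R (diag \<tau> *v g)"
      by (simp add: diag_mult_vec vec_eq_iff)
    then show ?thesis
      using \<sigma>2 by (simp add: T' T_scale)
  qed
  ultimately show ?thesis
    by (simp add: rej_prob_def tail_def measure_distr vimage_def)
qed

lemma C_Het_eq_image_scales: "C_Het = (\<lambda>\<tau>. diag (\<chi> i. (\<tau> $ i)\<^sup>2)) ` scales"
  by (auto simp: C_Het_def scales_def)

lemma SUP_C_Het_rej_prob:
  assumes "\<And>z. T' (\<mu> + z) = T z" and "0 < \<sigma>2"
  shows "(SUP \<Sigma>\<in>C_Het. rej_prob T' C \<mu> (\<sigma>2 *\<^sub>R \<Sigma>)) = rejection_size C"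
  unfolding C_Het_eq_image_scales rejection_size_def image_image
  by (intro SUP_cong refl rej_prob_eq_tail[OF assms]) (simp add: scales_def)

lemma test_size_eq:
  assumes "M \<noteq> {}" and "\<And>\<mu> z. \<mu> \<in> M \<Longrightarrow> T' (\<mu> + z) = T z"
  shows "test_size M T' C = rejection_size C"
proof -
  have "test_size M T' C = (SUP \<mu>\<in>M. SUP \<sigma>2\<in>{0::real<..}. rejection_size C)"
    unfolding test_size_def using assms(2) by (intro SUP_cong refl SUP_C_Het_rej_prob) auto
  then show ?thesis
    using assms(1) by simp
qed

lemma C_star_eq:
  assumes "\<And>z. T' (\<mu> + z) = T z" and "I1 L = J"
  shows "C_star L T' \<mu> = concentration_level"
  unfolding C_star_def concentration_level_def assms by (simp add: Setcompr_eq_image)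

lemma alpha_star_eq:
  assumes "\<And>z. T' (\<mu> + z) = T z" and "I1 L = J"
  shows "alpha_star L T' \<mu> = rejection_size concentration_level"
  unfolding alpha_star_def C_star_eq[OF assms]
  using SUP_C_Het_rej_prob[of T' \<mu> 1, OF assms(1)] SUP_rejection_size by simp

lemma size_control:
  assumes "M \<noteq> {}" and "\<And>\<mu> z. \<mu> \<in> M \<Longrightarrow> T' (\<mu> + z) = T z" and "I1 L = J"
  shows "(\<forall>\<alpha>\<in>{0<..<1}. \<exists>C. test_size M T' C \<le> \<alpha>) \<and>
     (\<forall>\<mu>0\<in>M. \<forall>\<mu>1\<in>M. C_star L T' \<mu>0 = C_star L T' \<mu>1 \<and> alpha_star L T' \<mu>0 = alpha_star L T' \<mu>1) \<and>
     (\<forall>\<mu>0\<in>M. 0 < alpha_star L T' \<mu>0 \<and>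
        (\<forall>\<alpha>\<in>{0<..alpha_star L T' \<mu>0} \<inter> {0<..<1}. \<exists>C. test_size M T' C = \<alpha>))"
  and "\<forall>\<alpha>\<in>{0<..<1}. \<exists>C\<^sub>0. is_smallest C\<^sub>0 {C. test_size M T' C \<le> \<alpha>} \<and>
     ((\<exists>C. test_size M T' C = \<alpha>) \<longrightarrow> is_smallest C\<^sub>0 {C. test_size M T' C = \<alpha>})"
proof -
  have size: "test_size M T' = rejection_size"
    using test_size_eq[OF assms(1,2)] by blast
  have C: "C_star L T' \<mu> = concentration_level" if "\<mu> \<in> M" for \<mu>
    using assms(2)[OF that] assms(3) by (rule C_star_eq)
  have alpha: "alpha_star L T' \<mu> = rejection_size concentration_level" if "\<mu> \<in> M" for \<mu>
    using assms(2)[OF that] assms(3) by (rule alpha_star_eq)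
  show "(\<forall>\<alpha>\<in>{0<..<1}. \<exists>C. test_size M T' C \<le> \<alpha>) \<and>
     (\<forall>\<mu>0\<in>M. \<forall>\<mu>1\<in>M. C_star L T' \<mu>0 = C_star L T' \<mu>1 \<and> alpha_star L T' \<mu>0 = alpha_star L T' \<mu>1) \<and>
     (\<forall>\<mu>0\<in>M. 0 < alpha_star L T' \<mu>0 \<and>
        (\<forall>\<alpha>\<in>{0<..alpha_star L T' \<mu>0} \<inter> {0<..<1}. \<exists>C. test_size M T' C = \<alpha>))"
    unfolding size using ex_rejection_size_le ex_rejection_size_eq rejection_size_pos
    by (auto simp: C alpha)
  show "\<forall>\<alpha>\<in>{0<..<1}. \<exists>C\<^sub>0. is_smallest C\<^sub>0 {C. test_size M T' C \<le> \<alpha>} \<and>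
     ((\<exists>C. test_size M T' C = \<alpha>) \<longrightarrow> is_smallest C\<^sub>0 {C. test_size M T' C = \<alpha>})"
    unfolding size
  proof
    fix \<alpha> :: real assume "\<alpha> \<in> {0<..<1}"
    then obtain C\<^sub>0 where C\<^sub>0: "is_smallest C\<^sub>0 {C. rejection_size C \<le> \<alpha>}"
      using ex_smallest_critical_value by blast
    \<comment> \<open>A level with size \<alpha> is admissible, hence not below
      \<open>C\<^sub>0\<close>; antitonicity then makes the size at \<open>C\<^sub>0\<close> at
      least \<alpha> and so equal to it.\<close>
    have "is_smallest C\<^sub>0 {C. rejection_size C = \<alpha>}" if "rejection_size C = \<alpha>" for C
    proof -
      have "\<alpha> \<le> rejection_size C\<^sub>0"
        using C\<^sub>0 that rejection_size_antimono[of C\<^sub>0 C] by (simp add: is_smallest_def)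
      with C\<^sub>0 show ?thesis
        by (simp add: is_smallest_def)
    qed
    with C\<^sub>0 show "\<exists>C\<^sub>0. is_smallest C\<^sub>0 {C. rejection_size C \<le> \<alpha>} \<and>
     ((\<exists>C. rejection_size C = \<alpha>) \<longrightarrow> is_smallest C\<^sub>0 {C. rejection_size C = \<alpha>})"
      by blast
  qed
qed

end


subsection \<open>Quadratic test statistics for linear hypotheses\<close>

text \<open>\<open>A\<close> is the matrix of \<open>y \<mapsto> R \<beta>\<close> for the least squares estimator \<open>\<beta>\<close>. Both test statistics are
  quadratic forms in \<open>A y\<close> with matrix inverse to \<open>A diag(w y) A'\<close>, for suitable weights \<open>w\<close>.\<close>

locale linear_hypothesis =
  fixes X :: "real^'k^'n" and R :: "real^'k^'q"
  assumes k_less_n: "CARD('k) < CARD('n)"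
    and rank_X: "rank X = CARD('k)"
    and rank_R: "rank R = CARD('q)"
begin

definition A :: "real^'n^'q" where
  "A = R ** matrix_inv (transpose X ** X) ** transpose X"

lemma X_injective: "X *v b = 0 \<longleftrightarrow> b = 0"
  using rank_X by (metis full_rank_injective injD matrix_vector_mult_0_right)

lemma det_gram: "det (transpose X ** X) \<noteq> 0"
  unfolding det_neq_0_iff_kernel
proof (intro allI impI)
  fix b assume "(transpose X ** X) *v b = 0"
  then have "b \<bullet> (transpose X *v (X *v b)) = 0"
    by (simp add: matrix_vector_mul_assoc del: transpose_matrix_vector)
  then have "(X *v b) \<bullet> (X *v b) = 0"
    by (simp only: inner_matrix_vector_mult transpose_transpose)
  then show "b = 0"
    by (simp add: X_injective)
qed

lemma R_beta_hat: "R *v beta_hat X y = A *v y"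
  by (simp only: beta_hat_def A_def matrix_vector_mul_assoc matrix_mul_assoc)

lemma beta_hat_X: "beta_hat X (X *v b) = b"
  unfolding beta_hat_def
  by (simp only: matrix_vector_mul_assoc matrix_mul_assoc[symmetric] matrix_inv_left[OF det_gram] matrix_vector_mul_lid)

lemma A_X: "A *v (X *v b) = R *v b"
  by (simp only: R_beta_hat[symmetric] beta_hat_X)

lemma linear_beta_hat: "linear (beta_hat X)"
  by (rule linearI) (simp_all add: beta_hat_def matrix_vector_right_distrib matrix_vector_mult_scaleR
      del: transpose_matrix_vector)

lemma linear_u_hat: "linear (u_hat X)"
  by (rule linearI) (simp_all add: u_hat_def linear_add[OF linear_beta_hat] linear_scale[OF linear_beta_hat]
      matrix_vector_right_distrib matrix_vector_mult_scaleR algebra_simps)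

lemma u_hat_X: "u_hat X (X *v b) = 0"
  by (simp add: u_hat_def beta_hat_X)

lemma u_hat_add_X: "u_hat X (y + X *v b) = u_hat X y"
  by (simp add: linear_add[OF linear_u_hat] u_hat_X)

lemma u_hat_eq_0_iff: "u_hat X y = 0 \<longleftrightarrow> y \<in> col_space X"
proof -
  have "col_space X = range ((*v) X)"
    unfolding columns_image_basis
    by (simp add: span_linear_image matrix_vector_mul_linear span_axis)
  then show ?thesis
    by (auto simp: u_hat_X) (auto simp: u_hat_def)
qed

lemma R_surjective: obtains b where "R *v b = c"
  using rank_R by (metis full_rank_surjective surjD)

text \<open>On the column space of \<open>X\<close> the matrix \<open>A\<close> acts as
  \<open>R\<close> does on coefficients, and \<open>R\<close> is onto.\<close>

lemma rank_A: "rank A = CARD('q)"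
proof -
  have "\<exists>y. c = A *v y" for c
  proof -
    obtain b where "R *v b = c"
      by (rule R_surjective)
    then have "c = A *v (X *v b)"
      by (simp only: A_X)
    then show ?thesis ..
  qed
  then show ?thesis
    by (simp add: full_rank_surjective surj_def)
qed

lemma transpose_A: "transpose A = X ** matrix_inv (transpose X ** X) ** transpose R"
  using transpose_matrix_inv[OF det_gram]
  by (simp add: A_def matrix_transpose_mul matrix_mul_assoc)

lemma A_transpose_A: "A ** transpose A = R ** matrix_inv (transpose X ** X) ** transpose R"
proof -
  have "A ** transpose A = A ** (X ** matrix_inv (transpose X ** X) ** transpose R)"
    by (simp only: transpose_A)
  also have "\<dots> = R ** (matrix_inv (transpose X ** X) ** (transpose X ** X))
      ** matrix_inv (transpose X ** X) ** transpose R"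
    by (simp only: A_def matrix_mul_assoc)
  finally show ?thesis
    by (simp add: matrix_inv_left[OF det_gram])
qed

lemma subspace_M0_lin: "subspace (M0_lin X R)"
proof -
  have "M0_lin X R = (*v) X ` {b. R *v b = 0}"
    by (auto simp: M0_lin_def)
  moreover have "subspace {b. R *v b = 0}"
    by (simp add: subspace_def matrix_vector_right_distrib matrix_vector_mult_scaleR)
  ultimately show ?thesis
    by (simp add: linear_subspace_image matrix_vector_mul_linear)
qed

text \<open>Otherwise \<open>M0_lin X R\<close> would contain every axis and hence be the whole
  space, although it lies in the range of \<open>X\<close> and k < n.\<close>

lemma I1_nonempty: "I1 (M0_lin X R) \<noteq> {}"
proof
  assume "I1 (M0_lin X R) = {}"
  then have "range e \<subseteq> M0_lin X R"
    by (auto simp: I1_def I0_def)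
  then have "span (range e) \<subseteq> M0_lin X R"
    using subspace_M0_lin by (rule span_minimal)
  then have "M0_lin X R = UNIV"
    by (simp add: span_axis top.extremum_unique)
  then have "surj ((*v) X)"
    by (force simp: M0_lin_def)
  then show False
    using rank_X k_less_n by (simp add: full_rank_surjective[symmetric])
qed

text \<open>The coordinates in which the vectors may differ have indices in \<open>I0\<close>, whose
  axes span a subspace of \<open>M0_lin X R\<close>.\<close>

lemma diff_mem_M0_lin:
  assumes "\<And>i. i \<in> I1 (M0_lin X R) \<Longrightarrow> y $ i = z $ i"
  shows "y - z \<in> M0_lin X R"
proof -
  have "(\<Sum>i\<in>UNIV. (y - z) $ i *\<^sub>R e i) \<in> M0_lin X R"
  proof (intro subspace_sum[OF subspace_M0_lin])
    fix i
    show "(y - z) $ i *\<^sub>R e i \<in> M0_lin X R"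
      using assms[of i] subspace_scale[OF subspace_M0_lin] subspace_0[OF subspace_M0_lin]
      by (cases "i \<in> I1 (M0_lin X R)") (auto simp: I1_def I0_def)
  qed
  also have "(\<Sum>i\<in>UNIV. (y - z) $ i *\<^sub>R e i) = y - z"
    using basis_expansion[of "y - z"] by (simp add: scalar_mult_eq_scaleR)
  finally show ?thesis .
qed

end

text \<open>For \<open>T_uc\<close> all weights equal \<open>sigma2_hat\<close>; for
  \<open>T_Het\<close> they are the squared residuals times the constants in \<open>d\<close>. Both
  are quadratic in the residuals, which explains homogeneity of degree two and invariance under the
  column space.\<close>

locale weighted_statistic = linear_hypothesis X R
  for X :: "real^'k^'n" and R :: "real^'k^'q" +
  fixes w :: "real^'n \<Rightarrow> real^'n"
  assumes poly_w: "real_polynomial_function (\<lambda>z. w z $ i)"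
    and w_scale: "w (c *\<^sub>R z) = c\<^sup>2 *\<^sub>R w z"
    and w_add_X: "w (z + X *v b) = w z"
    and w_nonneg: "0 \<le> w z $ i"
begin

definition S :: "real^'n \<Rightarrow> real^'q^'q" where
  "S z = A ** diag (w z) ** transpose A"

text \<open>The test statistic recentered at a point of the null hypothesis, so that
  \<open>r\<close> no longer occurs.\<close>

definition T\<^sub>0 :: "real^'n \<Rightarrow> real" where
  "T\<^sub>0 z = (if det (S z) \<noteq> 0 then quad_form (matrix_inv (S z)) (A *v z) else 0)"

lemma S_scale: "S (c *\<^sub>R z) = c\<^sup>2 *\<^sub>R S z"
proof -
  have "diag (c *\<^sub>R v) = c *\<^sub>R diag v" for c and v :: "real^'n"
    by (simp add: diag_def vec_eq_iff)
  then show ?thesis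
    by (simp add: S_def w_scale scalar_matrix_assoc matrix_scalar_ac)
qed

lemma S_add_X: "S (z + X *v b) = S z"
  by (simp add: S_def w_add_X)

lemma quad_form_S_pos: "det (S z) \<noteq> 0 \<Longrightarrow> v \<noteq> 0 \<Longrightarrow> 0 < quad_form (matrix_inv (S z)) v"
  unfolding S_def by (intro quad_form_weighted_gram_pos w_nonneg)

text \<open>Adding elements of the column space leaves \<open>S\<close> fixed while moving
  \<open>A *v z\<close> to any prescribed vector, so the form can be made arbitrarily large along a
  ray.\<close>

lemma T\<^sub>0_unbounded:
  assumes "det (S z) \<noteq> 0"
  shows "\<exists>y. C < T\<^sub>0 y"
proof -
  define v :: "real^'q" where "v = (\<chi> i. 1)"
  define p where "p = quad_form (matrix_inv (S z)) v"
  \<comment> \<open>The bound \<open>1 \<le> c\<close> gives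
    \<open>c * p \<le> c\<^sup>2 * p\<close>, and the second argument of the maximum gives
    \<open>C < c * p\<close>.\<close>
  define c where "c = max 1 (C / p + 1)"
  have p: "0 < p"
    unfolding p_def by (intro quad_form_S_pos assms) (simp add: v_def vec_eq_iff)
  obtain b where b: "R *v b = c *\<^sub>R v - A *v z"
    by (rule R_surjective)
  then have "A *v (z + X *v b) = c *\<^sub>R v"
    by (simp add: matrix_vector_right_distrib A_X)
  then have "T\<^sub>0 (z + X *v b) = quad_form (matrix_inv (S z)) (c *\<^sub>R v)"
    using assms by (simp add: T\<^sub>0_def S_add_X)
  also have "\<dots> = c\<^sup>2 * p"
    by (simp add: quad_form_def p_def matrix_vector_mult_scaleR power2_eq_square)
  also have "c * p \<le> c\<^sup>2 * p"
    using p by (intro mult_right_mono self_le_power) (auto simp: c_def)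
  moreover have "C < c * p"
    using p by (simp add: c_def max_def field_simps)
  ultimately show ?thesis
    by (metis order_less_le_trans)
qed

lemma T\<^sub>0_scale:
  assumes "0 < c"
  shows "T\<^sub>0 (c *\<^sub>R z) = T\<^sub>0 z"
  using assms
  by (simp add: T\<^sub>0_def S_scale det_scaleR_neq_0_iff[simplified] matrix_inv_scaleR quad_form_def
      scaleR_matrix_vector_assoc[symmetric] matrix_vector_mult_scaleR power2_eq_square)

lemma T\<^sub>0_nonneg: "0 \<le> T\<^sub>0 z"
  using quad_form_S_pos[of z "A *v z"] by (cases "A *v z = 0") (auto simp: T\<^sub>0_def quad_form_def)

lemma T\<^sub>0_cong:
  assumes "\<And>i. i \<in> I1 (M0_lin X R) \<Longrightarrow> y $ i = z $ i"
  shows "T\<^sub>0 y = T\<^sub>0 z"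
proof -
  obtain b where b: "y - z = X *v b" "R *v b = 0"
    using diff_mem_M0_lin[OF assms] by (auto simp: M0_lin_def)
  then have "y = z + X *v b"
    by (simp add: algebra_simps)
  with b(2) show ?thesis
    by (simp add: T\<^sub>0_def S_add_X matrix_vector_right_distrib A_X)
qed

lemma rational_statistic_T\<^sub>0:
  assumes det_S_axis: "\<And>i. i \<in> I1 (M0_lin X R) \<Longrightarrow> det (S (e i)) \<noteq> 0"
  shows "rational_statistic T\<^sub>0
    (\<lambda>z. \<Sum>k\<in>UNIV. (A *v z) $ k * det (\<chi> i j. if j = k then (A *v z) $ i else S z $ i $ j))
    (\<lambda>z. det (S z)) (I1 (M0_lin X R))"
proof
  have Az: "real_polynomial_function (\<lambda>z. (A *v z) $ i)" for i
    by (intro real_polynomial_function_vec_nth_linear matrix_vector_mul_linear)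
  have S: "real_polynomial_function (\<lambda>z. S z $ i $ j)" for i j
    unfolding S_def by (intro real_polynomial_function_weighted_gram poly_w)
  then show "real_polynomial_function (\<lambda>z. det (S z))"
    by (rule real_polynomial_function_det)
  have "real_polynomial_function (\<lambda>z. (\<chi> i j. if j = k then (A *v z) $ i else S z $ i $ j) $ i $ j)"
    for i j k
    by (cases "j = k") (simp_all add: Az S)
  then show "real_polynomial_function
      (\<lambda>z. \<Sum>k\<in>UNIV. (A *v z) $ k * det (\<chi> i j. if j = k then (A *v z) $ i else S z $ i $ j))"
    by (intro real_polynomial_function_sum real_polynomial_function.intros(4) finite Az
        real_polynomial_function_det)
  show "T\<^sub>0 z = (\<Sum>k\<in>UNIV. (A *v z) $ k * det (\<chi> i j. if j = k then (A *v z) $ i else S z $ i $ j))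
      / det (S z)" for z
    by (simp add: T\<^sub>0_def quad_form_matrix_inv_cramer)
  show "I1 (M0_lin X R) \<noteq> {}"
    by (rule I1_nonempty)
  \<comment> \<open>Any index in \<open>I1\<close> provides an axis vector with invertible
    \<open>S\<close>, from which the statistic grows without bound.\<close>
  then show "\<exists>z. C < T\<^sub>0 z" for C
    using T\<^sub>0_unbounded det_S_axis by blast
qed (fact T\<^sub>0_scale T\<^sub>0_cong T\<^sub>0_nonneg det_S_axis)+

lemma size_control:
  assumes T': "\<And>\<mu> z. \<mu> \<in> M0 X R r \<Longrightarrow> T' (\<mu> + z) = T\<^sub>0 z"
    and "\<And>i. i \<in> I1 (M0_lin X R) \<Longrightarrow> det (S (e i)) \<noteq> 0"
  defines "M \<equiv> M0 X R r" and "L \<equiv> M0_lin X R"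
  shows "(\<forall>\<alpha>\<in>{0<..<1}. \<exists>C. test_size M T' C \<le> \<alpha>) \<and>
     (\<forall>\<mu>0\<in>M. \<forall>\<mu>1\<in>M. C_star L T' \<mu>0 = C_star L T' \<mu>1 \<and> alpha_star L T' \<mu>0 = alpha_star L T' \<mu>1) \<and>
     (\<forall>\<mu>0\<in>M. 0 < alpha_star L T' \<mu>0 \<and>
        (\<forall>\<alpha>\<in>{0<..alpha_star L T' \<mu>0} \<inter> {0<..<1}. \<exists>C. test_size M T' C = \<alpha>))"
  and "\<forall>\<alpha>\<in>{0<..<1}. \<exists>C\<^sub>0. is_smallest C\<^sub>0 {C. test_size M T' C \<le> \<alpha>} \<and>
     ((\<exists>C. test_size M T' C = \<alpha>) \<longrightarrow> is_smallest C\<^sub>0 {C. test_size M T' C = \<alpha>})"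
proof -
  obtain b where "R *v b = r"
    by (rule R_surjective)
  then have "M \<noteq> {}"
    by (auto simp: M_def M0_def)
  note * = rational_statistic.size_control[OF rational_statistic_T\<^sub>0[OF assms(2)] this
      T'[folded M_def], folded L_def, OF _ _ refl]
  show "(\<forall>\<alpha>\<in>{0<..<1}. \<exists>C. test_size M T' C \<le> \<alpha>) \<and>
     (\<forall>\<mu>0\<in>M. \<forall>\<mu>1\<in>M. C_star L T' \<mu>0 = C_star L T' \<mu>1 \<and> alpha_star L T' \<mu>0 = alpha_star L T' \<mu>1) \<and>
     (\<forall>\<mu>0\<in>M. 0 < alpha_star L T' \<mu>0 \<and>
        (\<forall>\<alpha>\<in>{0<..alpha_star L T' \<mu>0} \<inter> {0<..<1}. \<exists>C. test_size M T' C = \<alpha>))"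
    by (rule *(1))
  show "\<forall>\<alpha>\<in>{0<..<1}. \<exists>C\<^sub>0. is_smallest C\<^sub>0 {C. test_size M T' C \<le> \<alpha>} \<and>
     ((\<exists>C. test_size M T' C = \<alpha>) \<longrightarrow> is_smallest C\<^sub>0 {C. test_size M T' C = \<alpha>})"
    by (rule *(2))
qed

end

section \<open>The uncorrected statistic \<open>T_uc\<close>\<close>

context linear_hypothesis
begin

lemma M0_add:
  assumes "\<mu> \<in> M0 X R r"
  shows "u_hat X (\<mu> + z) = u_hat X z" and "R *v beta_hat X (\<mu> + z) - r = A *v z"
    and "\<mu> + z \<in> col_space X \<longleftrightarrow> z \<in> col_space X"
proof -
  obtain b where b: "\<mu> = X *v b" "R *v b = r"
    using assms by (auto simp: M0_def)
  show u_hat: "u_hat X (\<mu> + z) = u_hat X z"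
    using u_hat_add_X[of z b] by (simp add: b(1) add.commute)
  show "R *v beta_hat X (\<mu> + z) - r = A *v z"
    by (simp add: R_beta_hat matrix_vector_right_distrib b(1) A_X b(2))
  show "\<mu> + z \<in> col_space X \<longleftrightarrow> z \<in> col_space X"
    by (simp only: u_hat_eq_0_iff[symmetric] u_hat)
qed

lemma real_polynomial_function_u_hat: "real_polynomial_function (\<lambda>z. u_hat X z $ i)"
  by (intro real_polynomial_function_vec_nth_linear linear_u_hat)

lemma sigma2_hat_pos: "0 < sigma2_hat X z \<longleftrightarrow> z \<notin> col_space X"
  using k_less_n by (simp add: sigma2_hat_def zero_less_divide_iff u_hat_eq_0_iff)

sublocale uc: weighted_statistic X R "\<lambda>z. \<chi> i. sigma2_hat X z"
proof
  show "real_polynomial_function (\<lambda>z. (\<chi> i. sigma2_hat X z) $ i)" for i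
    unfolding sigma2_hat_def inner_vec_def vec_lambda_beta inner_real_def
    by (intro real_polynomial_function_divide real_polynomial_function_sum finite
        real_polynomial_function.intros(4) real_polynomial_function_u_hat)
  show "(\<chi> i. sigma2_hat X (c *\<^sub>R z)) = c\<^sup>2 *\<^sub>R (\<chi> i. sigma2_hat X z)" for c z
    by (simp add: vec_eq_iff sigma2_hat_def linear_scale[OF linear_u_hat] power2_eq_square)
  show "(\<chi> i. sigma2_hat X (z + X *v b)) = (\<chi> i. sigma2_hat X z)" for z b
    by (simp add: sigma2_hat_def u_hat_add_X)
  show "0 \<le> (\<chi> i. sigma2_hat X z) $ i" for z i
    using k_less_n by (simp add: sigma2_hat_def)
qed

lemma uc_S: "uc.S z = sigma2_hat X z *\<^sub>R (R ** matrix_inv (transpose X ** X) ** transpose R)"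
proof -
  have "diag (\<chi> i. c) = c *\<^sub>R (mat 1 :: real^'n^'n)" for c
    by (simp add: diag_def mat_def vec_eq_iff)
  then show ?thesis
    by (simp add: uc.S_def A_transpose_A[symmetric] matrix_scalar_ac scalar_matrix_assoc)
qed

text \<open>Matches the case distinction in \<open>T_uc\<close>, by membership in the column space,
  with the one in \<open>uc.T\<^sub>0\<close>, by the determinant.\<close>

lemma det_uc_S: "det (uc.S z) \<noteq> 0 \<longleftrightarrow> z \<notin> col_space X"
proof
  assume "z \<notin> col_space X"
  then show "det (uc.S z) \<noteq> 0"
    unfolding uc.S_def by (intro det_weighted_gram_neq_0 rank_A) (simp add: sigma2_hat_pos)
next
  assume det: "det (uc.S z) \<noteq> 0"
  show "z \<notin> col_space X"
  proof
    assume "z \<in> col_space X"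
    then have "sigma2_hat X z = 0"
      by (simp add: sigma2_hat_def u_hat_eq_0_iff[symmetric])
    then have "uc.S z *v (\<chi> i. 1) = 0"
      by (simp add: uc_S)
    with det have "(\<chi> i. 1) = (0 :: real^'q)"
      unfolding det_neq_0_iff_kernel by blast
    then show False
      by (simp add: vec_eq_iff)
  qed
qed

lemma T_uc_add:
  assumes "\<mu> \<in> M0 X R r"
  shows "T_uc X R r (\<mu> + z) = uc.T\<^sub>0 z"
proof -
  have "sigma2_hat X (\<mu> + z) = sigma2_hat X z"
    by (simp add: sigma2_hat_def M0_add[OF assms])
  then show ?thesis
    unfolding T_uc_def uc.T\<^sub>0_def det_uc_S M0_add[OF assms] by (simp only: uc_S)
qed

lemma N_uc_det:
  assumes "N_uc X R" and "i \<in> I1 (M0_lin X R)"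
  shows "det (uc.S (e i)) \<noteq> 0"
  using assms by (simp add: det_uc_S[simplified] N_uc_def)

end

section \<open>The heteroskedasticity-robust statistic \<open>T_Het\<close>\<close>

locale heteroskedasticity_robust = linear_hypothesis X R
  for X :: "real^'k^'n" and R :: "real^'k^'q" +
  fixes d :: "real^'n"
  assumes d_pos: "0 < d $ i"
begin

sublocale het: weighted_statistic X R "\<lambda>z. \<chi> i. d $ i * (u_hat X z $ i)\<^sup>2"
proof
  show "real_polynomial_function (\<lambda>z. (\<chi> i. d $ i * (u_hat X z $ i)\<^sup>2) $ i)" for i
    unfolding vec_lambda_beta
    by (intro real_polynomial_function.intros(2,4) real_polynomial_function_power
        real_polynomial_function_u_hat)
  show "(\<chi> i. d $ i * (u_hat X (c *\<^sub>R z) $ i)\<^sup>2) = c\<^sup>2 *\<^sub>R (\<chi> i. d $ i * (u_hat X z $ i)\<^sup>2)" for c z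
    by (simp add: vec_eq_iff linear_scale[OF linear_u_hat] power_mult_distrib)
  show "(\<chi> i. d $ i * (u_hat X (z + X *v b) $ i)\<^sup>2) = (\<chi> i. d $ i * (u_hat X z $ i)\<^sup>2)" for z b
    by (simp add: u_hat_add_X)
  show "0 \<le> (\<chi> i. d $ i * (u_hat X z $ i)\<^sup>2) $ i" for z i
    using d_pos by (simp add: less_imp_le)
qed

lemma het_S: "het.S z = Omega_Het d X R z"
  unfolding het.S_def Omega_Het_def transpose_A by (simp only: A_def matrix_mul_assoc)

lemma T_Het_add:
  assumes "\<mu> \<in> M0 X R r"
  shows "T_Het d X R r (\<mu> + z) = het.T\<^sub>0 z"
proof -
  have "Omega_Het d X R (\<mu> + z) = Omega_Het d X R z"
    by (simp add: Omega_Het_def M0_add[OF assms])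
  then show ?thesis
    by (simp add: T_Het_def het.T\<^sub>0_def het_S M0_add[OF assms])
qed

text \<open>With \<open>B = B_mat X R (e i)\<close>, the covariance estimator at \<open>e i\<close>
  factors as \<open>B ** diag d ** transpose B\<close>. Full row rank of \<open>B\<close> and
  positivity of \<open>d\<close> make it invertible.\<close>

lemma N_Het_det:
  assumes "N_Het X R" and "i \<in> I1 (M0_lin X R)"
  shows "det (het.S (e i)) \<noteq> 0"
proof -
  define B where "B = B_mat X R (e i)"
  have B: "B = A ** diag (u_hat X (e i))"
    by (simp add: B_def B_mat_def A_def)
  have "\<not> rank B < CARD('q)"
    using assms by (simp add: N_Het_def B_set_def B_def)
  then have "rank B = CARD('q)"
    using rank_bound[of B] by simp
  then have "det (B ** diag d ** transpose B) \<noteq> 0"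
    using d_pos by (rule det_weighted_gram_neq_0)
  moreover have "transpose (diag v) = diag v" for v :: "real^'n"
    by (auto simp: transpose_def diag_def vec_eq_iff)
  then have "B ** diag d ** transpose B
      = A ** (diag (u_hat X (e i)) ** diag d ** diag (u_hat X (e i))) ** transpose A"
    by (simp add: B matrix_transpose_mul matrix_mul_assoc)
  then have "B ** diag d ** transpose B = het.S (e i)"
    unfolding het.S_def by (simp add: diag_mult_diag power2_eq_square mult_ac)
  ultimately show ?thesis
    by simp
qed

end

theorem theorem5p1:
  fixes X :: "real^'k^'n" and R :: "real^'k^'q" and r :: "real^'q" and d :: "real^'n"
  assumes "CARD('k) < CARD('n)"
    and "rank X = CARD('k)"
    and "rank R = CARD('q)"
    and "\<forall>i. 0 < d $ i"
  shows
    "(N_uc X R \<longrightarrow>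
        (\<forall>\<alpha>\<in>{0<..<1}. \<exists>C. test_size (M0 X R r) (T_uc X R r) C \<le> \<alpha>) \<and>
        (\<forall>\<mu>0\<in>M0 X R r. \<forall>\<mu>1\<in>M0 X R r.
           C_star (M0_lin X R) (T_uc X R r) \<mu>0 = C_star (M0_lin X R) (T_uc X R r) \<mu>1 \<and>
           alpha_star (M0_lin X R) (T_uc X R r) \<mu>0 = alpha_star (M0_lin X R) (T_uc X R r) \<mu>1) \<and>
        (\<forall>\<mu>0\<in>M0 X R r.
           0 < alpha_star (M0_lin X R) (T_uc X R r) \<mu>0 \<and>
           (\<forall>\<alpha>\<in>{0<..alpha_star (M0_lin X R) (T_uc X R r) \<mu>0} \<inter> {0<..<1}.
              \<exists>C. test_size (M0 X R r) (T_uc X R r) C = \<alpha>)))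
     \<and>
     (Assumption1 X R \<and> N_Het X R \<longrightarrow>
        (\<forall>\<alpha>\<in>{0<..<1}. \<exists>C. test_size (M0 X R r) (T_Het d X R r) C \<le> \<alpha>) \<and>
        (\<forall>\<mu>0\<in>M0 X R r. \<forall>\<mu>1\<in>M0 X R r.
           C_star (M0_lin X R) (T_Het d X R r) \<mu>0 = C_star (M0_lin X R) (T_Het d X R r) \<mu>1 \<and>
           alpha_star (M0_lin X R) (T_Het d X R r) \<mu>0 = alpha_star (M0_lin X R) (T_Het d X R r) \<mu>1) \<and>
        (\<forall>\<mu>0\<in>M0 X R r.
           0 < alpha_star (M0_lin X R) (T_Het d X R r) \<mu>0 \<and>
           (\<forall>\<alpha>\<in>{0<..alpha_star (M0_lin X R) (T_Het d X R r) \<mu>0} \<inter> {0<..<1}.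
              \<exists>C. test_size (M0 X R r) (T_Het d X R r) C = \<alpha>)))
     \<and>
     (N_uc X R \<longrightarrow>
        (\<forall>\<alpha>\<in>{0<..<1}. \<exists>C\<^sub>0.
           is_smallest C\<^sub>0 {C. test_size (M0 X R r) (T_uc X R r) C \<le> \<alpha>} \<and>
           ((\<exists>C. test_size (M0 X R r) (T_uc X R r) C = \<alpha>) \<longrightarrow>
              is_smallest C\<^sub>0 {C. test_size (M0 X R r) (T_uc X R r) C = \<alpha>})))
     \<and>
     (Assumption1 X R \<and> N_Het X R \<longrightarrow>
        (\<forall>\<alpha>\<in>{0<..<1}. \<exists>C\<^sub>0.
           is_smallest C\<^sub>0 {C. test_size (M0 X R r) (T_Het d X R r) C \<le> \<alpha>} \<and>
           ((\<exists>C. test_size (M0 X R r) (T_Het d X R r) C = \<alpha>) \<longrightarrow>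
              is_smallest C\<^sub>0 {C. test_size (M0 X R r) (T_Het d X R r) C = \<alpha>})))"
proof -
  interpret heteroskedasticity_robust X R d
    by unfold_locales (use assms in simp_all)
  note uc = uc.size_control[OF T_uc_add N_uc_det]
  note het = het.size_control[OF T_Het_add N_Het_det]
  show ?thesis
    by (intro conjI[OF impI conjI[OF impI conjI[OF impI impI]]])
       (rule uc(1), assumption+, (erule conjE, rule het(1), assumption+), (rule uc(2), assumption+),
         (erule conjE, rule het(2), assumption+))
qed

end
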